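(* Let $G$ be a metric graph with Cheeger-type constant $h(G)$. Then $$\lambda_1^{\min}(G)\le 4h(G).$$
   Context: A metric graph $G=(V,E,\ell)$ is given by a finite connected graph $(V,E)$ with at least one edge (loops and multiple edges allowed) and edge lengths $\ell:E\to(0,\infty)$: each edge $e$ is (after choosing an orientation) identified with the interval $[0,\ell(e)]$, and $G$ is the compact topological space obtained by gluing endpoints of edges corresponding to the same vertex. $(V,E,\ell)$ is called a model of $G$. A model is essential if either $(V,E)$ has no vertices of degree two (loops counted twice in the degree), or $(V,E)$ consists of one vertex and one loop edge; every metric graph has an essential model. Cheeger-type constant: fix an essential model $(V,E,\ell)$ of $G$ (the value does not depend on which one). For $Y\subset V$ let $\delta Y$ be the set of edges connecting a vertex in $Y$ with a vertex in $V\setminus Y$, and $|\delta Y|=\sum_{e\in\delta Y}\frac{1}{\ell(e)}$. Then $$h(G):=\min\Big\{\min_{\emptyset\subsetneq Y\subsetneq V}|\delta Y|,\ \min_{e_1\neq e_2\in E}\Big(\frac{1}{\ell(e_1)}+\frac{1}{\ell(e_2)}\Big),\ \min_{e\in E}\frac{4}{\ell(e)}\Big\},$$ where a minimum over an empty set is $+\infty$. $dx$ is the Lebesgue measure on $G$. $H^1(G)$ is the space of continuous $f:G\to\mathbb{R}$ whose restriction to every open edge lies in $H^1((0,\ell(e)))$; $q(f,g)=\int_G f'g'\,dx$. A function $f\in H^1(G)$ is harmonic on an open set $O\subset G$ if $q(f,g)=0$ for all $g\in H^1(G)$ with $g\equiv 0$ on $G\setminus O$. For a Borel probability measure $\mu$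 on $G$, let $H^1(G,\mu)=\{f\in H^1(G): f \text{ harmonic on } G\setminus\operatorname{supp}\mu\}$, regarded (injectively) as a dense subspace of $L^2(G,\mu)$. $H_\mu$ is the non-negative self-adjoint operator in $L^2(G,\mu)$ associated with the closed form $q|_{H^1(G,\mu)}$: $f\in\operatorname{dom}(H_\mu)$ and $H_\mu f=g$ iff $f\in H^1(G,\mu)$ and $q(f,\varphi)=\int_G g\varphi\,d\mu$ for all $\varphi\in H^1(G,\mu)$. Its spectrum is discrete; its eigenvalues, counted with multiplicity, are $0=\lambda_0(H_\mu)<\lambda_1(H_\mu)\le\cdots$, with $\lambda_k(H_\mu):=+\infty$ for $k\ge\dim L^2(G,\mu)$. Let $\lambda_k^{\min}(G):=\min_{\mu}\lambda_k(H_\mu)$ over all Borel probability measures $\mu$ on $G$ (attained). *)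

theory Defs
  imports
    "HOL-Probability.Probability"
    "Graph_Theory.Digraph_Component"
begin

section \<open>Metric graphs\<close>

text \<open>
  A finite multigraph is a digraph of \<^emph>\<open>Graph_Theory\<close>: the direction of an arc is
  the chosen orientation of the edge. Loops and parallel arcs are allowed in \<^locale>\<open>fin_digraph\<close>,
  and \<^const>\<open>Digraph_Component.connected\<close> ignores the directions.
\<close>

locale metric_graph = fin_digraph G for G :: "('v, 'e) pre_digraph" +
  fixes len :: "'e \<Rightarrow> real"
  assumes connected: "Digraph_Component.connected G"
    and arcs_nonempty: "arcs G \<noteq> {}"
    and len_pos: "\<And>e. e \<in> arcs G \<Longrightarrow> len e > 0"

text \<open>A loop contributes to both the in-degree and the out-degree, hence counts twice.\<close>

definition essential :: "('v, 'e) pre_digraph \<Rightarrow> bool" where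
  "essential G \<longleftrightarrow>
     (\<forall>v\<in>verts G. in_degree G v + out_degree G v \<noteq> 2) \<or>
     (\<exists>v e. verts G = {v} \<and> arcs G = {e} \<and> tail G e = v \<and> head G e = v)"

subsection \<open>The glued space\<close>

text \<open>
  Instead of equivalence classes, the points of the quotient are represented canonically:
  end points of edge intervals become the vertex they are attached to.
\<close>

datatype ('v, 'e) point = Vertex 'v | Inner 'e real

definition chart :: "('v, 'e) pre_digraph \<Rightarrow> ('e \<Rightarrow> real) \<Rightarrow> 'e \<Rightarrow> real \<Rightarrow> ('v, 'e) point" where
  "chart G len e x =
     (if x = 0 then Vertex (tail G e)
      else if x = len e then Vertex (head G e)
      else Inner e x)"

definition edge_space :: "('v, 'e) pre_digraph \<Rightarrow> ('e \<Rightarrow> real) \<Rightarrow> ('e \<times> real) topology" where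
  "edge_space G len = sum_topology (\<lambda>e. top_of_set {0..len e}) (arcs G)"

text \<open>
  Since a metric graph is connected with at least one edge, every vertex is an end point of an
  edge and therefore lies in the image of the charts.
\<close>

definition points :: "('v, 'e) pre_digraph \<Rightarrow> ('e \<Rightarrow> real) \<Rightarrow> ('v, 'e) point set" where
  "points G len = case_prod (chart G len) ` topspace (edge_space G len)"

definition mg_topology :: "('v, 'e) pre_digraph \<Rightarrow> ('e \<Rightarrow> real) \<Rightarrow> ('v, 'e) point topology" where
  "mg_topology G len = topology (\<lambda>U. U \<subseteq> points G len \<and>
     openin (edge_space G len) {p \<in> topspace (edge_space G len). case_prod (chart G len) p \<in> U})"

lemma openin_mg_topology:
  "openin (mg_topology G len) U \<longleftrightarrow> U \<subseteq> points G len \<and>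
     openin (edge_space G len) {p \<in> topspace (edge_space G len). case_prod (chart G len) p \<in> U}"
proof -
  let ?X = "edge_space G len" and ?p = "case_prod (chart G len)"
  have 1: "{p \<in> topspace ?X. ?p p \<in> S \<inter> T} =
      {p \<in> topspace ?X. ?p p \<in> S} \<inter> {p \<in> topspace ?X. ?p p \<in> T}" for S T
    by auto
  have 2: "{p \<in> topspace ?X. ?p p \<in> \<Union>K} = (\<Union>S\<in>K. {p \<in> topspace ?X. ?p p \<in> S})" for K
    by auto
  have "istopology (\<lambda>U. U \<subseteq> points G len \<and> openin ?X {p \<in> topspace ?X. ?p p \<in> U})"
    unfolding istopology_def 1 2 by blast
  then show ?thesis
    by (simp add: mg_topology_def)
qed

lemma topspace_mg_topology [simp]: "topspace (mg_topology G len) = points G len"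
proof -
  have "{p \<in> topspace (edge_space G len). case_prod (chart G len) p \<in> points G len}
      = topspace (edge_space G len)"
    by (auto simp: points_def)
  then have "openin (mg_topology G len) (points G len)"
    by (simp add: openin_mg_topology)
  then show ?thesis
    by (metis openin_mg_topology openin_subset openin_topspace subset_antisym)
qed

lemma quotient_map_chart:
  "quotient_map (edge_space G len) (mg_topology G len) (case_prod (chart G len))"
  by (auto simp: quotient_map_def openin_mg_topology points_def)

lemma (in metric_graph) Vertex_in_points:
  assumes v: "v \<in> verts G"
  shows "Vertex v \<in> points G len"
proof -
  obtain e where e: "e \<in> arcs G" "tail G e = v \<or> head G e = v"
  proof (cases "\<exists>w\<in>verts G. w \<noteq> v")
    case True
    then obtain w where w: "w \<in> verts G" "w \<noteq> v" by blast
    have "v \<rightarrow>\<^sup>*\<^bsub>with_proj (mk_symmetric G)\<^esub> w"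
      using connected v w by (auto simp: Digraph_Component.connected_def strongly_connected_def)
    then have "(v, w) \<in> rtrancl_on (pverts (mk_symmetric G)) (parcs (mk_symmetric G))"
      by (simp add: reachable_def)
    then have "\<exists>u. (v, u) \<in> parcs (mk_symmetric G)"
      using w(2) by (induction rule: converse_rtrancl_on_induct) auto
    then show ?thesis
      using that by (auto simp: mk_symmetric_def)
  next
    case False
    then show ?thesis
      using arcs_nonempty that tail_in_verts by blast
  qed
  then have "chart G len e 0 = Vertex v \<or> chart G len e (len e) = Vertex v"
    using len_pos[of e] by (auto simp: chart_def)
  moreover have "(e, 0) \<in> topspace (edge_space G len)" "(e, len e) \<in> topspace (edge_space G len)"
    using e(1) len_pos[of e] by (auto simp: edge_space_def)
  ultimately show ?thesis
    unfolding points_def by (metis (mono_tags, lifting) case_prod_conv image_eqI)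
qed

section \<open>The Cheeger-type constant\<close>

definition edge_boundary :: "('v, 'e) pre_digraph \<Rightarrow> 'v set \<Rightarrow> 'e set" where
  "edge_boundary G Y = {e \<in> arcs G.
     tail G e \<in> Y \<and> head G e \<in> verts G - Y \<or> head G e \<in> Y \<and> tail G e \<in> verts G - Y}"

text \<open>
  The index sets are finite, so each infimum is a minimum or, over an empty index set, \<open>\<infinity>\<close>.
  The formula defines the constant of the glued space only if \<open>(G, len)\<close> is an essential model of
  it; every metric graph has one, and all notions below depend on the glued space alone.
\<close>

definition cheeger :: "('v, 'e) pre_digraph \<Rightarrow> ('e \<Rightarrow> real) \<Rightarrow> ereal" where
  "cheeger G len =
     min (INF Y\<in>{Y. Y \<noteq> {} \<and> Y \<subset> verts G}. ereal (\<Sum>e\<in>edge_boundary G Y. 1 / len e))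
       (min (INF (e1, e2)\<in>{(e1, e2). e1 \<in> arcs G \<and> e2 \<in> arcs G \<and> e1 \<noteq> e2}.
               ereal (1 / len e1 + 1 / len e2))
            (INF e\<in>arcs G. ereal (4 / len e)))"

section \<open>Sobolev spaces and the Dirichlet form\<close>

definition L2_interval :: "real \<Rightarrow> (real \<Rightarrow> real) \<Rightarrow> bool" where
  "L2_interval l u \<longleftrightarrow> u \<in> borel_measurable (lebesgue_on {0<..<l}) \<and>
     integrable (lebesgue_on {0<..<l}) (\<lambda>x. (u x)\<^sup>2)"

text \<open>As in Brezis' textbook, weak derivatives on an interval are tested with \<open>C\<^sub>c\<^sup>1\<close> functions.\<close>

definition test_fun :: "real \<Rightarrow> (real \<Rightarrow> real) \<Rightarrow> bool" where
  "test_fun l \<phi> \<longleftrightarrow> \<phi> C1_differentiable_on UNIV \<and>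
     (\<exists>K. compact K \<and> K \<subseteq> {0<..<l} \<and> (\<forall>x. x \<notin> K \<longrightarrow> \<phi> x = 0))"

definition weak_deriv :: "real \<Rightarrow> (real \<Rightarrow> real) \<Rightarrow> (real \<Rightarrow> real) \<Rightarrow> bool" where
  "weak_deriv l u v \<longleftrightarrow> (\<forall>\<phi>. test_fun l \<phi> \<longrightarrow>
     (LINT x|lebesgue_on {0<..<l}. u x * deriv \<phi> x) = - (LINT x|lebesgue_on {0<..<l}. v x * \<phi> x))"

definition H1_interval :: "real \<Rightarrow> (real \<Rightarrow> real) \<Rightarrow> bool" where
  "H1_interval l u \<longleftrightarrow> L2_interval l u \<and> (\<exists>v. L2_interval l v \<and> weak_deriv l u v)"

text \<open>
  Functions on the metric graph are functions on the type of all points; their values outside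
  \<^const>\<open>points\<close> are irrelevant throughout.
\<close>

definition H1 :: "('v, 'e) pre_digraph \<Rightarrow> ('e \<Rightarrow> real) \<Rightarrow> (('v, 'e) point \<Rightarrow> real) set" where
  "H1 G len = {f. continuous_map (mg_topology G len) euclideanreal f \<and>
     (\<forall>e\<in>arcs G. H1_interval (len e) (\<lambda>x. f (chart G len e x)))}"

text \<open>The weak derivative is unique almost everywhere, so the choice does not affect integrals.\<close>

definition edge_deriv ::
  "('v, 'e) pre_digraph \<Rightarrow> ('e \<Rightarrow> real) \<Rightarrow> (('v, 'e) point \<Rightarrow> real) \<Rightarrow> 'e \<Rightarrow> real \<Rightarrow> real" where
  "edge_deriv G len f e =
     (SOME v. L2_interval (len e) v \<and> weak_deriv (len e) (\<lambda>x. f (chart G len e x)) v)"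

text \<open>Vertices are null sets for \<open>dx\<close>, so \<open>\<integral>\<^sub>G f' g' dx\<close> is the sum over the open edges.\<close>

definition dirichlet_form ::
  "('v, 'e) pre_digraph \<Rightarrow> ('e \<Rightarrow> real) \<Rightarrow>
   (('v, 'e) point \<Rightarrow> real) \<Rightarrow> (('v, 'e) point \<Rightarrow> real) \<Rightarrow> real" where
  "dirichlet_form G len f g =
     (\<Sum>e\<in>arcs G. LINT x|lebesgue_on {0<..<len e}. edge_deriv G len f e x * edge_deriv G len g e x)"

definition harmonic_on ::
  "('v, 'e) pre_digraph \<Rightarrow> ('e \<Rightarrow> real) \<Rightarrow> ('v, 'e) point set \<Rightarrow> (('v, 'e) point \<Rightarrow> real) \<Rightarrow> bool" where
  "harmonic_on G len S f \<longleftrightarrow> f \<in> H1 G len \<and>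
     (\<forall>g\<in>H1 G len. (\<forall>x\<in>points G len - S. g x = 0) \<longrightarrow> dirichlet_form G len f g = 0)"

section \<open>The operator of a probability measure\<close>

definition mg_borel :: "('v, 'e) pre_digraph \<Rightarrow> ('e \<Rightarrow> real) \<Rightarrow> ('v, 'e) point measure" where
  "mg_borel G len = sigma (points G len) {U. openin (mg_topology G len) U}"

definition borel_prob_measures ::
  "('v, 'e) pre_digraph \<Rightarrow> ('e \<Rightarrow> real) \<Rightarrow> ('v, 'e) point measure set" where
  "borel_prob_measures G len = {\<mu>. prob_space \<mu> \<and> sets \<mu> = sets (mg_borel G len)}"

definition msupp ::
  "('v, 'e) pre_digraph \<Rightarrow> ('e \<Rightarrow> real) \<Rightarrow> ('v, 'e) point measure \<Rightarrow> ('v, 'e) point set" where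
  "msupp G len \<mu> = {x \<in> points G len.
     \<forall>U. openin (mg_topology G len) U \<and> x \<in> U \<longrightarrow> emeasure \<mu> U > 0}"

definition H1_measure ::
  "('v, 'e) pre_digraph \<Rightarrow> ('e \<Rightarrow> real) \<Rightarrow> ('v, 'e) point measure \<Rightarrow> (('v, 'e) point \<Rightarrow> real) set" where
  "H1_measure G len \<mu> = {f \<in> H1 G len. harmonic_on G len (points G len - msupp G len \<mu>) f}"

text \<open>\<open>op_graph G len \<mu> f g\<close> says that \<open>f\<close> is in the domain of \<open>H\<^sub>\<mu>\<close> and \<open>H\<^sub>\<mu> f = g\<close> in \<open>L\<^sup>2(\<mu>)\<close>.\<close>

definition op_graph ::
  "('v, 'e) pre_digraph \<Rightarrow> ('e \<Rightarrow> real) \<Rightarrow> ('v, 'e) point measure \<Rightarrow>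
   (('v, 'e) point \<Rightarrow> real) \<Rightarrow> (('v, 'e) point \<Rightarrow> real) \<Rightarrow> bool" where
  "op_graph G len \<mu> f g \<longleftrightarrow>
     f \<in> H1_measure G len \<mu> \<and>
     g \<in> borel_measurable \<mu> \<and> integrable \<mu> (\<lambda>x. (g x)\<^sup>2) \<and>
     (\<forall>\<phi>\<in>H1_measure G len \<mu>. dirichlet_form G len f \<phi> = (LINT x|\<mu>. g x * \<phi> x))"

section \<open>Eigenvalues\<close>

text \<open>Linear independence of the classes of \<open>f\<^sub>0, \<dots>, f\<^sub>n\<^sub>-\<^sub>1\<close> modulo equality almost everywhere.\<close>

definition lin_indep_AE :: "'a measure \<Rightarrow> nat \<Rightarrow> (nat \<Rightarrow> 'a \<Rightarrow> real) \<Rightarrow> bool" where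
  "lin_indep_AE \<mu> n f \<longleftrightarrow>
     (\<forall>c :: nat \<Rightarrow> real. (AE x in \<mu>. (\<Sum>i<n. c i * f i x) = 0) \<longrightarrow> (\<forall>i<n. c i = 0))"

text \<open>Dimension of the eigenspace for \<open>t\<close> in \<open>L\<^sup>2(\<mu>)\<close>; it is \<open>0\<close> if \<open>t\<close> is not an eigenvalue.\<close>

definition eig_mult ::
  "('v, 'e) pre_digraph \<Rightarrow> ('e \<Rightarrow> real) \<Rightarrow> ('v, 'e) point measure \<Rightarrow> real \<Rightarrow> enat" where
  "eig_mult G len \<mu> t =
     (SUP n\<in>{n. \<exists>f. lin_indep_AE \<mu> n f \<and> (\<forall>i<n. op_graph G len \<mu> (f i) (\<lambda>x. t * f i x))}. enat n)"

text \<open>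
  The \<open>k\<close>-th entry (starting from \<open>0\<close>) of the increasing enumeration of the eigenvalues with
  multiplicity is the least \<open>t\<close> such that the eigenvalues up to \<open>t\<close> have total multiplicity
  greater than \<open>k\<close>. If there is no such \<open>t\<close>, i.e. if \<open>k \<ge> dim L\<^sup>2(\<mu>)\<close>, the infimum is \<open>\<infinity>\<close>.
\<close>

definition eigval ::
  "('v, 'e) pre_digraph \<Rightarrow> ('e \<Rightarrow> real) \<Rightarrow> ('v, 'e) point measure \<Rightarrow> nat \<Rightarrow> ereal" where
  "eigval G len \<mu> k =
     (INF t\<in>{t. \<exists>S. finite S \<and> S \<subseteq> {..t} \<and> enat k < (\<Sum>s\<in>S. eig_mult G len \<mu> s)}. ereal t)"

definition eigval_min :: "('v, 'e) pre_digraph \<Rightarrow> ('e \<Rightarrow> real) \<Rightarrow> nat \<Rightarrow> ereal" where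
  "eigval_min G len k = (INF \<mu>\<in>borel_prob_measures G len. eigval G len \<mu> k)"

end

theory Submission
  imports Defs
begin

text \<open>
  For the measure \<open>\<mu> = (\<delta>\<^sub>a + \<delta>\<^sub>b) / 2\<close> the space \<open>H\<^sup>1(G, \<mu>)\<close> is two-dimensional, and
  \<open>\<lambda>\<^sub>1(H\<^sub>\<mu>)\<close> is four times the effective conductance between \<open>a\<close> and \<open>b\<close>. By Dirichlet's principle
  the latter is at most \<open>q(w, w)\<close> for every \<open>w\<close> with \<open>w(a) = 1\<close> and \<open>w(b) = 0\<close>. Each of the three
  minima in the Cheeger-type constant comes from one such \<open>w\<close>: the affine extension of the indicator
  of \<open>Y\<close>; a function that is constant except near the midpoints \<open>a\<close>, \<open>b\<close> of \<open>e\<^sub>1\<close>, \<open>e\<^sub>2\<close>; and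
  the tent function of a single edge. Only vertices and midpoints occur as \<open>a\<close> and \<open>b\<close>, so all
  functions can be taken affine on half-edges, and the potential theory is that of a finite network.
\<close>

section \<open>Finite networks\<close>

text \<open>The energy form of an electrical network with conductances \<open>c\<close>. Edges are
  indices with end points \<open>p i\<close> and \<open>q i\<close>, which accommodates loops and
  parallel edges.\<close>

definition network_form :: "'i set \<Rightarrow> ('i \<Rightarrow> real) \<Rightarrow> ('i \<Rightarrow> 'p) \<Rightarrow> ('i \<Rightarrow> 'p) \<Rightarrow> ('p \<Rightarrow> real) \<Rightarrow> ('p \<Rightarrow> real) \<Rightarrow> real"
  where "network_form I c p q u g = (\<Sum>i\<in>I. c i * ((u (q i) - u (p i)) * (g (q i) - g (p i))))"

text \<open>Clipping to [0, 1] is 1-Lipschitz, so no potential difference grows.\<close>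

lemma network_form_truncate_le:
  fixes w :: "'p \<Rightarrow> real"
  assumes "\<And>i. i \<in> I \<Longrightarrow> 0 \<le> c i"
  defines "w' \<equiv> \<lambda>x. max 0 (min 1 (w x))"
  shows "network_form I c p q w' w' \<le> network_form I c p q w w"
  unfolding network_form_def
proof (intro sum_mono mult_left_mono assms)
  fix i
  have "\<bar>w' (q i) - w' (p i)\<bar> \<le> \<bar>w (q i) - w (p i)\<bar>"
    unfolding w'_def by linarith
  then show "(w' (q i) - w' (p i)) * (w' (q i) - w' (p i)) \<le> (w (q i) - w (p i)) * (w (q i) - w (p i))"
    by (metis abs_mult_self_eq abs_ge_zero mult_mono)
qed

text \<open>Truncation to \<open>[0, 1]\<close> makes Tychonoff's theorem applicable.\<close>

lemma network_minimizer_exists: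
  fixes c :: "'i \<Rightarrow> real" and p q :: "'i \<Rightarrow> 'p"
  assumes c: "\<And>i. i \<in> I \<Longrightarrow> 0 \<le> c i" and "a \<noteq> b"
  shows "\<exists>u. u a = 1 \<and> u b = 0 \<and>
    (\<forall>w. w a = 1 \<longrightarrow> w b = 0 \<longrightarrow> network_form I c p q u u \<le> network_form I c p q w w)"
proof -
  \<comment> \<open>The boundary values are built in as singleton factors. A product of compact sets
    is compact over any index set, so the type of nodes may be infinite.\<close>
  define K :: "('p \<Rightarrow> real) set"
    where "K = PiE UNIV (\<lambda>x. if x = a then {1} else if x = b then {0} else {0..1})"
  have "compactin (product_topology (\<lambda>i. euclidean) UNIV) K"
    unfolding K_def compactin_PiE by auto
  then have "compact K"
    by (simp add: euclidean_product_topology)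
  moreover have "(\<lambda>x. if x = a then 1 else 0) \<in> K"
    using \<open>a \<noteq> b\<close> by (auto simp: K_def)
  moreover have "continuous_on K (\<lambda>w. network_form I c p q w w)"
    unfolding network_form_def
    by (intro continuous_intros continuous_on_subset[OF continuous_on_product_coordinates]) auto
  ultimately obtain u where u: "u \<in> K"
      "\<And>w. w \<in> K \<Longrightarrow> network_form I c p q u u \<le> network_form I c p q w w"
    using continuous_attains_inf[of K] by blast
  show ?thesis
  proof (intro exI conjI allI impI)
    show "u a = 1" "u b = 0"
      using PiE_mem[OF u(1)[unfolded K_def], of a] PiE_mem[OF u(1)[unfolded K_def], of b] \<open>a \<noteq> b\<close>
      by auto
  next
    fix w :: "'p \<Rightarrow> real" assume w: "w a = 1" "w b = 0"
    have "(\<lambda>x. max 0 (min 1 (w x))) \<in> K"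
      using w by (auto simp: K_def)
    then show "network_form I c p q u u \<le> network_form I c p q w w"
      by (rule order_trans[OF u(2) network_form_truncate_le[OF c]])
  qed
qed

text \<open>First variation: the polynomial is minimal at \<open>t = 0\<close>, where its derivative
  is \<open>2 * B\<close>.\<close>

lemma quadratic_nonneg_imp_linear_zero:
  fixes B C :: real
  assumes nonneg: "\<And>t. 0 \<le> 2 * t * B + t\<^sup>2 * C"
  shows "B = 0"
proof (rule ccontr)
  assume "B \<noteq> 0"
  \<comment> \<open>\<open>d\<close> is a positive upper bound for \<open>C\<close>, which may be
    zero or negative; \<open>- B / d\<close> stands in for the minimizer
    \<open>- B / C\<close>.\<close>
  define d where "d = \<bar>C\<bar> + 1"
  have d: "d > 0" "C \<le> d" by (auto simp: d_def)
  have "0 \<le> 2 * (- B / d) * B + (- B / d)\<^sup>2 * C"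
    by (rule nonneg)
  also have "\<dots> \<le> 2 * (- B / d) * B + (- B / d)\<^sup>2 * d"
    using d by (intro add_left_mono mult_left_mono) auto
  also have "\<dots> = - (B\<^sup>2 / d)"
    using d by (simp add: field_simps power2_eq_square)
  also have "\<dots> < 0"
    using d \<open>B \<noteq> 0\<close> by simp
  finally show False by simp
qed

text \<open>Minimality makes \<open>u\<close> orthogonal to every potential vanishing at
  \<open>a\<close> and \<open>b\<close>. Subtracting from \<open>g\<close> the combination of
  \<open>u\<close> and a constant that shares its values there leaves such a potential, and the form
  annihilates constants. The factor \<open>network_form I c p q u u\<close> is the effective
  conductance between \<open>a\<close> and \<open>b\<close>.\<close>

lemma network_green:
  fixes c :: "'i \<Rightarrow> real" and p q :: "'i \<Rightarrow> 'p" and g :: "'p \<Rightarrow> real"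
  assumes c: "\<And>i. i \<in> I \<Longrightarrow> 0 \<le> c i" and u: "u a = 1" "u b = 0"
    and min: "\<And>w. w a = 1 \<Longrightarrow> w b = 0 \<Longrightarrow> network_form I c p q u u \<le> network_form I c p q w w"
  shows "network_form I c p q u g = network_form I c p q u u * (g a - g b)"
proof -
  define h where "h x = g x - g b - (g a - g b) * u x" for x
  have "network_form I c p q u h = 0"
  proof (rule quadratic_nonneg_imp_linear_zero)
    fix t :: real
    have "network_form I c p q u u \<le> network_form I c p q (\<lambda>x. u x + t * h x) (\<lambda>x. u x + t * h x)"
      by (rule min) (auto simp: h_def u)
    also have "\<dots> = network_form I c p q u u + 2 * t * network_form I c p q u h + t\<^sup>2 * network_form I c p q h h"
      unfolding network_form_def sum_distrib_left sum.distrib[symmetric]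
      by (rule sum.cong) (auto simp: algebra_simps power2_eq_square)
    finally show "0 \<le> 2 * t * network_form I c p q u h + t\<^sup>2 * network_form I c p q h h" by simp
  qed
  moreover have "network_form I c p q u h = network_form I c p q u g - network_form I c p q u u * (g a - g b)"
    unfolding network_form_def h_def sum_distrib_right sum_subtractf[symmetric]
    by (rule sum.cong) (auto simp: algebra_simps)
  ultimately show ?thesis by simp
qed

section \<open>Weak derivatives on an interval\<close>

definition pos_sq :: "real \<Rightarrow> real" where "pos_sq s = (max 0 s)\<^sup>2"

text \<open>The first-order error is at most \<open>h\<^sup>2\<close> for all signs of
  \<open>s\<close> and \<open>s + h\<close>, so the join at 0 needs no one-sided derivatives.
  Truncated squares are C^1, which is the smoothness that \<open>test_fun\<close> asks for.\<close>

lemma has_field_derivative_pos_sq: "(pos_sq has_real_derivative 2 * max 0 s) (at s)"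
proof -
  have "((\<lambda>h. (pos_sq (s + h) - pos_sq s) / h - 2 * max 0 s) \<longlongrightarrow> 0) (at 0)"
  proof (rule Lim_null_comparison)
    have "norm ((pos_sq (s + h) - pos_sq s) / h - 2 * max 0 s) \<le> \<bar>h\<bar>" if "h \<noteq> 0" for h
    proof -
      have "\<bar>pos_sq (s + h) - pos_sq s - 2 * max 0 s * h\<bar> \<le> h\<^sup>2"
      proof (cases "0 \<le> s"; cases "0 \<le> s + h")
        assume "0 \<le> s" "\<not> 0 \<le> s + h"
        moreover have "0 \<le> (s + h)\<^sup>2"
          by simp
        moreover have "0 \<le> s * (- s - 2 * h)"
          using calculation by (intro mult_nonneg_nonneg) auto
        ultimately show ?thesis
          by (auto simp: pos_sq_def max_def power2_eq_square algebra_simps abs_le_iff)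
      next
        assume "\<not> 0 \<le> s" "0 \<le> s + h"
        then have "(s + h)\<^sup>2 \<le> h\<^sup>2"
          by (intro power_mono) auto
        then show ?thesis
          using \<open>\<not> 0 \<le> s\<close> \<open>0 \<le> s + h\<close> by (auto simp: pos_sq_def max_def)
      qed (auto simp: pos_sq_def max_def power2_eq_square algebra_simps)
      then have "\<bar>pos_sq (s + h) - pos_sq s - 2 * max 0 s * h\<bar> / \<bar>h\<bar> \<le> h\<^sup>2 / \<bar>h\<bar>"
        by (intro divide_right_mono) auto
      moreover have "(pos_sq (s + h) - pos_sq s) / h - 2 * max 0 s = (pos_sq (s + h) - pos_sq s - 2 * max 0 s * h) / h"
        using that by (simp add: field_simps)
      moreover have "h\<^sup>2 / \<bar>h\<bar> = \<bar>h\<bar>"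
        using that by (metis abs_mult_self_eq abs_eq_0 nonzero_mult_div_cancel_left power2_eq_square)
      ultimately show ?thesis by simp
    qed
    then show "\<forall>\<^sub>F h in at 0. norm ((pos_sq (s + h) - pos_sq s) / h - 2 * max 0 s) \<le> \<bar>h\<bar>"
      by (auto simp: eventually_at_filter)
    show "((\<lambda>h::real. \<bar>h\<bar>) \<longlongrightarrow> 0) (at 0)"
      by (intro tendsto_eq_intros) auto
  qed
  then show ?thesis
    by (simp add: DERIV_def LIM_zero_iff)
qed

text \<open>The quadratic spline with knots 0, 1 / 2 and 1 that climbs from 0 to 1.\<close>

definition smooth_step :: "real \<Rightarrow> real"
  where "smooth_step s = 2 * (pos_sq s - 2 * pos_sq (s - 1/2) + pos_sq (s - 1))"

text \<open>The tent on [0, 1] with peak 2; it has unit mass, being the derivative of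
  \<open>smooth_step\<close>.\<close>

definition hat :: "real \<Rightarrow> real"
  where "hat s = 4 * (max 0 s - 2 * max 0 (s - 1/2) + max 0 (s - 1))"

lemma DERIV_smooth_step [derivative_intros]:
  assumes "(f has_real_derivative D) (at x within S)"
  shows "((\<lambda>x. smooth_step (f x)) has_real_derivative hat (f x) * D) (at x within S)"
proof -
  have "(smooth_step has_real_derivative hat s) (at s)" for s
    unfolding smooth_step_def hat_def
    by (rule derivative_eq_intros DERIV_chain2[OF has_field_derivative_pos_sq] refl | simp)+
  then show ?thesis
    using assms by (rule DERIV_chain2)
qed

lemma continuous_on_hat [continuous_intros]: "continuous_on S f \<Longrightarrow> continuous_on S (\<lambda>x. hat (f x))"
  unfolding hat_def by (intro continuous_intros) auto

lemma hat_nonneg: "0 \<le> hat s"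
  unfolding hat_def by (auto simp: max_def)

lemma hat_eq_0: "s \<le> 0 \<or> 1 \<le> s \<Longrightarrow> hat s = 0"
  unfolding hat_def by (auto simp: max_def)

lemma smooth_step_eq_0: "s \<le> 0 \<Longrightarrow> smooth_step s = 0"
  unfolding smooth_step_def pos_sq_def by (auto simp: max_def)

lemma smooth_step_eq_1: "1 \<le> s \<Longrightarrow> smooth_step s = 1"
  unfolding smooth_step_def pos_sq_def by (auto simp: max_def power2_eq_square algebra_simps)

lemma smooth_step_bounds: "0 \<le> smooth_step s" "smooth_step s \<le> 1"
proof -
  have mono: "smooth_step x \<le> smooth_step y" if "x \<le> y" for x y
    using that by (rule DERIV_nonneg_imp_nondecreasing)
      (auto intro!: exI derivative_eq_intros hat_nonneg)
  show "0 \<le> smooth_step s" "smooth_step s \<le> 1"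
    using mono[of "min s 0" s] mono[of s "max s 1"]
    by (auto simp: smooth_step_eq_0 smooth_step_eq_1)
qed

section \<open>Integrals over an open interval and approximate identities\<close>

text \<open>Links the Lebesgue integral over an open edge to the gauge integral, for which the
  fundamental theorem of calculus is stated.\<close>

lemma integrable_Ioo_continuous:
  fixes f :: "real \<Rightarrow> real"
  assumes "continuous_on {0..l} f"
  shows "integrable (lebesgue_on {0<..<l}) f"
    and "(LINT x|lebesgue_on {0<..<l}. f x) = integral {0..l} f"
proof -
  have "set_integrable lebesgue {0..l} f"
    using assms by (rule absolutely_integrable_continuous_real)
  then have "set_integrable lebesgue {0<..<l} f"
    by (rule set_integrable_subset) auto
  then show *: "integrable (lebesgue_on {0<..<l}) f"
    by (simp add: integrable_restrict_space set_integrable_def)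
  show "(LINT x|lebesgue_on {0<..<l}. f x) = integral {0..l} f"
    using * by (simp add: lebesgue_integral_eq_integral integral_open_interval_real)
qed

lemma L2_interval_integrable:
  assumes "L2_interval l v"
  shows "integrable (lebesgue_on {0<..<l}) v"
proof -
  interpret finite_measure "lebesgue_on {0<..<l}"
    by (rule finite_measure_lebesgue_on) auto
  show ?thesis
    using assms unfolding L2_interval_def by (blast intro: square_integrable_imp_integrable)
qed

lemma Ioo_in_sets_lebesgue_on:
  assumes "0 \<le> a" "b \<le> l"
  shows "{a<..<b} \<in> sets (lebesgue_on {0<..<l :: real})"
  using assms by (subst sets_restrict_space_iff) auto

lemma integral_hat:
  assumes "0 < n" "0 \<le> c" "c + 1 / n \<le> l"
  shows "integral {0..l} (\<lambda>s. n * hat (n * (s - c))) = 1"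
proof -
  have "0 < 1 / n" using assms by simp
  then have "0 \<le> l" using assms by linarith
  have "((\<lambda>s. n * hat (n * (s - c))) has_integral (smooth_step (n * (l - c)) - smooth_step (n * (0 - c)))) {0..l}"
    using \<open>0 \<le> l\<close>
    by (intro fundamental_theorem_of_calculus)
      (auto simp flip: has_real_derivative_iff_has_vector_derivative intro!: derivative_eq_intros)
  moreover have "n * (l - c) \<ge> 1"
    using assms by (simp add: field_simps)
  ultimately show ?thesis
    using assms by (intro integral_unique) (simp add: smooth_step_eq_0 smooth_step_eq_1 mult_nonneg_nonneg)
qed

text \<open>The kernels have unit mass and live on \<open>[d n, d n + 1 / n]\<close>, which shrinks
  to \<open>c\<close>. Letting the left end \<open>d n\<close> move keeps the kernels inside
  \<open>{0..l}\<close> even when \<open>c\<close> is an end point.\<close>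

lemma hat_approximate_identity:
  fixes u :: "real \<Rightarrow> real"
  assumes u: "continuous_on {0..l} u" and c: "c \<in> {0..l}" "d \<longlonglongrightarrow> c"
    and d: "\<forall>\<^sub>F n in sequentially. 0 \<le> d n \<and> d n + 1 / real n \<le> l"
  shows "(\<lambda>n. LINT s|lebesgue_on {0<..<l}. u s * (n * hat (n * (s - d n)))) \<longlonglongrightarrow> u c"
proof (rule tendstoI)
  fix e :: real assume "0 < e"
  then obtain r where r: "0 < r" "\<And>s. s \<in> {0..l} \<Longrightarrow> dist s c < r \<Longrightarrow> dist (u s) (u c) < e / 2"
    using u c(1) unfolding continuous_on_iff by (metis half_gt_zero)
  have "\<forall>\<^sub>F n in sequentially. dist (d n) c < r / 2"
    using r(1) by (intro tendstoD[OF c(2)]) auto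
  moreover have "\<forall>\<^sub>F n in sequentially. 1 / real n < r / 2"
    using r(1) by (intro order_tendstoD(2)[OF lim_1_over_n]) auto
  ultimately show "\<forall>\<^sub>F n in sequentially. dist (LINT s|lebesgue_on {0<..<l}. u s * (n * hat (n * (s - d n)))) (u c) < e"
    using d eventually_gt_at_top[of 0]
  proof eventually_elim
    case (elim n)
    let ?k = "\<lambda>s. n * hat (n * (s - d n))" and ?M = "lebesgue_on {0<..<l}"
    have ck: "continuous_on {0..l} ?k"
      by (intro continuous_intros)
    have k1: "(LINT s|?M. ?k s) = 1"
      unfolding integrable_Ioo_continuous(2)[OF ck] using elim by (intro integral_hat) auto
    have "(LINT s|?M. u c * ?k s) = u c"
      by (subst integral_mult_right_zero) (simp only: k1 mult_1_right)
    then have "(LINT s|?M. u s * ?k s) - u c = (LINT s|?M. u s * ?k s) - (LINT s|?M. u c * ?k s)"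
      by simp
    also have "\<dots> = (LINT s|?M. u s * ?k s - u c * ?k s)"
      by (intro Bochner_Integration.integral_diff[symmetric] integrable_Ioo_continuous
          continuous_intros u)
    finally have eq: "(LINT s|?M. u s * ?k s) - u c = (LINT s|?M. u s * ?k s - u c * ?k s)" .
    have "norm (LINT s|?M. u s * ?k s - u c * ?k s) \<le> (LINT s|?M. e / 2 * ?k s)"
    proof (rule Bochner_Integration.integral_norm_bound_integral)
      show "integrable ?M (\<lambda>s. u s * ?k s - u c * ?k s)" "integrable ?M (\<lambda>s. e / 2 * ?k s)"
        by (intro integrable_Ioo_continuous continuous_intros u)+
      fix s assume "s \<in> space ?M"
      then have s: "s \<in> {0..l}" by auto
      show "norm (u s * ?k s - u c * ?k s) \<le> e / 2 * ?k s"
      \<comment> \<open>Off the support both sides vanish; on it, \<open>s\<close> is within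
        \<open>r / 2\<close> of \<open>d n\<close>, hence within \<open>r\<close> of
        \<open>c\<close>.\<close>
      proof (cases "?k s = 0")
        case False
        then have "\<not> (n * (s - d n) \<le> 0 \<or> 1 \<le> n * (s - d n))"
          using hat_eq_0[of "n * (s - d n)"] by auto
        then have "0 < n * (s - d n)" "n * (s - d n) < 1"
          by linarith+
        then have "0 < s - d n" "s - d n < 1 / n"
          using elim(4) by (simp_all add: zero_less_mult_iff pos_less_divide_eq mult.commute)
        then have "dist s c < r"
          using elim(1,2) unfolding dist_real_def by linarith
        then have "\<bar>u s - u c\<bar> \<le> e / 2"
          using r(2)[OF s] by (simp add: dist_real_def)
        moreover have "0 \<le> ?k s"
          by (simp add: hat_nonneg)
        ultimately have "\<bar>u s - u c\<bar> * ?k s \<le> e / 2 * ?k s"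
          by (rule mult_right_mono)
        then show ?thesis
          using \<open>0 \<le> ?k s\<close>
          by (simp only: left_diff_distrib[symmetric] real_norm_def abs_mult[of "u s - u c"] abs_of_nonneg)
      qed auto
    qed
    also have "\<dots> = e / 2"
      by (subst integral_mult_right_zero) (simp only: k1 mult_1_right)
    also have "\<dots> < e"
      using \<open>0 < e\<close> by simp
    finally show ?case
      unfolding dist_real_def eq by simp
  qed
qed

section \<open>Plateau test functions and the fundamental theorem for weak derivatives\<close>

text \<open>A C^1 approximation of the indicator of \<open>{x<..<y}\<close>: it rises from
  \<open>x + 1 / n\<close> to \<open>x + 2 / n\<close> and falls from \<open>y - 2 / n\<close> to
  \<open>y - 1 / n\<close>, so its support stays away from \<open>x\<close> and
  \<open>y\<close>.\<close>

definition plateau :: "real \<Rightarrow> real \<Rightarrow> nat \<Rightarrow> real \<Rightarrow> real"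
  where "plateau x y n s = smooth_step (n * (s - (x + 1 / n))) - smooth_step (n * (s - (y - 2 / n)))"

lemma deriv_plateau:
  "deriv (plateau x y n) s = n * hat (n * (s - (x + 1 / n))) - n * hat (n * (s - (y - 2 / n)))"
  unfolding plateau_def[abs_def]
  by (rule DERIV_imp_deriv) (auto intro!: derivative_eq_intros)

text \<open>The bound on \<open>3 / real n\<close> places \<open>x + 1 / n\<close> not to the right
  of \<open>y - 2 / n\<close>, so both transitions stay between \<open>x + 1 / n\<close> and
  \<open>y - 1 / n\<close>.\<close>

lemma test_fun_plateau:
  assumes "0 \<le> x" "y \<le> l" "3 / real n \<le> y - x" "0 < n"
  shows "test_fun l (plateau x y n)"
  unfolding test_fun_def
proof (intro conjI exI allI impI)
  have "(plateau x y n has_vector_derivative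
      n * hat (n * (s - (x + 1 / n))) - n * hat (n * (s - (y - 2 / n)))) (at s)" for s
    unfolding plateau_def[abs_def]
    by (auto simp flip: has_real_derivative_iff_has_vector_derivative intro!: derivative_eq_intros)
  moreover have "continuous_on UNIV (\<lambda>s. n * hat (n * (s - (x + 1 / n))) - n * hat (n * (s - (y - 2 / n))))"
    by (intro continuous_intros)
  ultimately show "plateau x y n C1_differentiable_on UNIV"
    unfolding C1_differentiable_on_def by fast
  show "compact {x + 1 / n..y - 1 / n}"
    by simp
  have "0 < 1 / real n"
    using assms by simp
  then have "0 < x + 1 / n" "y - 1 / n < l"
    using assms by linarith+
  then show "{x + 1 / n..y - 1 / n} \<subseteq> {0<..<l}"
    by (auto simp del: zero_less_divide_iff)
  fix s assume "s \<notin> {x + 1 / n..y - 1 / n}"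
  then consider "s < x + 1 / n" | "y - 1 / n < s"
    by fastforce
  then show "plateau x y n s = 0"
  proof cases
    case 1
    then have "n * (s - (x + 1 / n)) \<le> 0" "n * (s - (y - 2 / n)) \<le> 0"
      using assms by (auto simp: mult_le_0_iff)
    then show ?thesis
      by (simp add: plateau_def smooth_step_eq_0)
  next
    case 2
    then have "1 / n \<le> s - (x + 1 / n)" "1 / n \<le> s - (y - 2 / n)"
      using assms by auto
    then have "1 \<le> n * (s - (x + 1 / n))" "1 \<le> n * (s - (y - 2 / n))"
      using assms(4) by (simp_all add: pos_divide_le_eq mult.commute)
    then show ?thesis
      by (simp add: plateau_def smooth_step_eq_1)
  qed
qed

text \<open>Every \<open>s\<close> inside ends up on the flat top, every other one off the support;
  \<open>x\<close> and \<open>y\<close> themselves count as outside because the transitions keep a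
  distance of \<open>1 / n\<close> from them.\<close>

lemma tendsto_plateau:
  assumes "x < y"
  shows "(\<lambda>n. plateau x y n s) \<longlonglongrightarrow> indicator {x<..<y} s"
proof (rule tendsto_eventually)
  have inv: "\<forall>\<^sub>F n in sequentially. a / real n < b" if "0 < b" for a b :: real
    using that by (intro order_tendstoD(2)[OF lim_const_over_n])
  consider "s \<le> x" | "x < s" "s < y" | "y \<le> s"
    by linarith
  then show "\<forall>\<^sub>F n in sequentially. plateau x y n s = indicator {x<..<y} s"
  proof cases
    case 1
    have "\<forall>\<^sub>F n in sequentially. 2 / real n < y - x"
      using assms by (intro inv) auto
    then show ?thesis
      using eventually_gt_at_top[of 0]
    proof eventually_elim
      case (elim n)
      have "0 < 1 / real n" using elim by simp
      then have "s - (x + 1 / n) \<le> 0" "s - (y - 2 / n) \<le> 0"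
        using elim 1 by linarith+
      then have "n * (s - (x + 1 / n)) \<le> 0" "n * (s - (y - 2 / n)) \<le> 0"
        by (auto simp only: mult_le_0_iff)
      then show ?case
        using 1 by (simp add: plateau_def smooth_step_eq_0)
    qed
  next
    case 2
    have "\<forall>\<^sub>F n in sequentially. 2 / real n < y - s" "\<forall>\<^sub>F n in sequentially. 2 / real n < s - x"
      using 2 by (intro inv; simp)+
    then show ?thesis
      using eventually_gt_at_top[of 0]
    proof eventually_elim
      case (elim n)
      then have "1 / n \<le> s - (x + 1 / n)" "s - (y - 2 / n) \<le> 0"
        by auto
      then have "1 \<le> n * (s - (x + 1 / n))" "n * (s - (y - 2 / n)) \<le> 0"
        using elim(3) by (simp_all add: pos_divide_le_eq mult.commute mult_le_0_iff)
      then show ?case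
        using 2 by (simp add: plateau_def smooth_step_eq_0 smooth_step_eq_1)
    qed
  next
    case 3
    have "\<forall>\<^sub>F n in sequentially. 2 / real n < y - x"
      using assms by (intro inv) auto
    then show ?thesis
      using eventually_gt_at_top[of 0]
    proof eventually_elim
      case (elim n)
      have "1 / n + 1 / n = 2 / n" "0 < 1 / real n"
        using elim by simp_all
      with elim have "1 / n \<le> s - (x + 1 / n)" "1 / n \<le> s - (y - 2 / n)"
        using 3 by linarith+
      then have "1 \<le> n * (s - (x + 1 / n))" "1 \<le> n * (s - (y - 2 / n))"
        using elim(2) by (simp_all add: pos_divide_le_eq mult.commute)
      then show ?case
        using 3 by (simp add: plateau_def smooth_step_eq_1)
    qed
  qed
qed

lemma abs_plateau_le: "\<bar>plateau x y n s\<bar> \<le> 1"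
  using smooth_step_bounds[of "n * (s - (x + 1 / n))"] smooth_step_bounds[of "n * (s - (y - 2 / n))"]
  by (auto simp: plateau_def)

lemma continuous_on_plateau: "continuous_on S (plateau x y n)"
proof -
  have "(plateau x y n has_real_derivative
      n * hat (n * (s - (x + 1 / n))) - n * hat (n * (s - (y - 2 / n)))) (at s)" for s
    unfolding plateau_def[abs_def] by (auto intro!: derivative_eq_intros)
  then show ?thesis
    by (meson DERIV_isCont continuous_at_imp_continuous_on)
qed

text \<open>The weak derivative is tested with plateaus. Dominated convergence turns one side into
  the integral of \<open>v\<close> over the interval; the derivative of a plateau is a difference of
  two narrow tents, so the other side converges to end point values of \<open>u\<close>.\<close>

lemma weak_deriv_integral:
  assumes xy: "0 \<le> x" "x < y" "y \<le> l"
    and u: "continuous_on {0..l} u" and v: "integrable (lebesgue_on {0<..<l}) v" and uv: "weak_deriv l u v"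
  shows "(LINT s|lebesgue_on {0<..<l}. indicator {x<..<y} s * v s) = u y - u x"
proof -
  let ?M = "lebesgue_on {0<..<l}"
  have conv: "(\<lambda>n. LINT s|?M. v s * plateau x y n s) \<longlonglongrightarrow> (LINT s|?M. v s * indicator {x<..<y} s)"
  proof (rule integral_dominated_convergence)
    have [measurable]: "v \<in> borel_measurable ?M"
      using v by simp
    have [measurable]: "plateau x y n \<in> borel_measurable ?M" for n
      by (intro measurable_restrict_space1 measurable_completion)
        (simp add: borel_measurable_continuous_onI continuous_on_plateau)
    show "(\<lambda>s. v s * plateau x y n s) \<in> borel_measurable ?M" for n
      by measurable
    show "(\<lambda>s. v s * indicator {x<..<y} s) \<in> borel_measurable ?M"
      using xy by (intro borel_measurable_times borel_measurable_indicator Ioo_in_sets_lebesgue_on) auto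
    show "integrable ?M (\<lambda>s. \<bar>v s\<bar>)"
      using v by simp
    show "AE s in ?M. (\<lambda>n. v s * plateau x y n s) \<longlonglongrightarrow> v s * indicator {x<..<y} s"
      by (intro always_eventually allI tendsto_intros tendsto_plateau xy)
    show "AE s in ?M. norm (v s * plateau x y n s) \<le> \<bar>v s\<bar>" for n
      using abs_plateau_le by (intro always_eventually allI) (simp add: abs_mult mult_left_le)
  qed
  have "(\<lambda>n. (LINT s|?M. u s * (n * hat (n * (s - (x + 1 / n))))) -
      (LINT s|?M. u s * (n * hat (n * (s - (y - 2 / n)))))) \<longlonglongrightarrow> u x - u y"
  proof (intro tendsto_diff hat_approximate_identity u)
    have *: "\<forall>\<^sub>F n in sequentially. 3 / real n < y - x"
      using xy by (intro order_tendstoD(2)[OF lim_const_over_n]) simp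
    show "\<forall>\<^sub>F n in sequentially. 0 \<le> x + 1 / real n \<and> x + 1 / real n + 1 / real n \<le> l"
      using * eventually_gt_at_top[of 0]
    proof eventually_elim
      case (elim n)
      then have "0 < 1 / real n" by simp
      then show ?case using elim xy by linarith
    qed
    show "\<forall>\<^sub>F n in sequentially. 0 \<le> y - 2 / real n \<and> y - 2 / real n + 1 / real n \<le> l"
      using * eventually_gt_at_top[of 0]
    proof eventually_elim
      case (elim n)
      then have "0 < 1 / real n" by simp
      then show ?case using elim xy by linarith
    qed
    show "(\<lambda>n. x + 1 / real n) \<longlonglongrightarrow> x"
      by (rule tendsto_eq_intros lim_const_over_n refl | simp)+
    show "(\<lambda>n. y - 2 / real n) \<longlonglongrightarrow> y"
      by (rule tendsto_eq_intros lim_const_over_n refl | simp)+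
  qed (use xy in auto)
  moreover have "\<forall>\<^sub>F n in sequentially. (LINT s|?M. u s * (n * hat (n * (s - (x + 1 / n))))) -
      (LINT s|?M. u s * (n * hat (n * (s - (y - 2 / n))))) = - (LINT s|?M. v s * plateau x y n s)"
  proof -
    have "\<forall>\<^sub>F n in sequentially. 3 / real n < y - x"
      using xy by (intro order_tendstoD(2)[OF lim_const_over_n]) simp
    then show ?thesis
      using eventually_gt_at_top[of 0]
    proof eventually_elim
      case (elim n)
      have "test_fun l (plateau x y n)"
        using elim xy by (intro test_fun_plateau) auto
      then have "(LINT s|?M. u s * deriv (plateau x y n) s) = - (LINT s|?M. v s * plateau x y n s)"
        using uv by (simp add: weak_deriv_def)
      moreover have "(LINT s|?M. u s * deriv (plateau x y n) s) =
          (LINT s|?M. u s * (n * hat (n * (s - (x + 1 / n)))) - u s * (n * hat (n * (s - (y - 2 / n)))))"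
        by (simp add: deriv_plateau right_diff_distrib)
      moreover have "\<dots> = (LINT s|?M. u s * (n * hat (n * (s - (x + 1 / n))))) -
          (LINT s|?M. u s * (n * hat (n * (s - (y - 2 / n)))))"
        by (intro Bochner_Integration.integral_diff integrable_Ioo_continuous continuous_intros u)
      ultimately show ?case by (simp only:)
    qed
  qed
  ultimately have "(\<lambda>n. - (LINT s|?M. v s * plateau x y n s)) \<longlonglongrightarrow> u x - u y"
    by (rule Lim_transform_eventually)
  then have "(\<lambda>n. LINT s|?M. v s * plateau x y n s) \<longlonglongrightarrow> - (u x - u y)"
    by (simp only: tendsto_minus_cancel_left)
  with conv have "(LINT s|?M. v s * indicator {x<..<y} s) = - (u x - u y)"
    by (rule LIMSEQ_unique)
  then show ?thesis
    by (simp add: mult.commute)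
qed

section \<open>Uniqueness of weak derivatives\<close>

text \<open>The sets over which \<open>f\<close> integrates to 0 form a Dynkin system, with
  \<open>total\<close> supplying the complements, and it contains the intersection-stable generator
  of open intervals.\<close>

lemma AE_zero_if_interval_integrals_zero:
  fixes f :: "real \<Rightarrow> real"
  assumes f: "integrable lborel f" and total: "(LINT x|lborel. f x) = 0"
    and int: "\<And>a b. a < b \<Longrightarrow> (LINT x|lborel. indicator {a<..<b} x * f x) = 0"
  shows "AE x in lborel. f x = 0"
proof (rule sigma_finite_measure.density_zero)
  show "sigma_finite_measure (lborel :: real measure)"
    by (rule sigma_finite_lborel)
  fix A :: "real set" assume "A \<in> sets lborel"
  then have A: "A \<in> sigma_sets UNIV (range (\<lambda>(a, b). box a b))"
    by (simp add: borel_eq_box)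
  have "Int_stable (range (\<lambda>(a, b). box a b :: real set))"
    by (auto simp: Int_stable_def Int_interval box_Int_box)
  moreover have "range (\<lambda>(a, b). box a b :: real set) \<subseteq> Pow UNIV"
    by simp
  ultimately show "(LINT x:A|lborel. f x) = 0"
    using A
  proof (induction rule: sigma_sets_induct_disjoint)
    case (basic A)
    then obtain a b where "A = {a<..<b}" by (auto simp: box_real)
    then show ?case
      using int[of a b] by (cases "a < b") (auto simp: set_lebesgue_integral_def)
  next
    case (compl A)
    then have A: "A \<in> sets lborel"
      by (simp add: borel_eq_box)
    have "(LINT x:A \<union> (UNIV - A)|lborel. f x) = (LINT x:A|lborel. f x) + (LINT x:UNIV - A|lborel. f x)"
      using A f integrable_mult_indicator[of _ lborel f]
      by (intro set_integral_Un) (auto simp: set_integrable_def)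
    then show ?case
      using compl total by (simp add: set_lebesgue_integral_def)
  next
    case (union A)
    then have A: "A i \<in> sets lborel" for i
      by (auto simp add: borel_eq_box)
    moreover have "set_integrable lborel (\<Union>i. A i) f"
      unfolding set_integrable_def using A f by (intro integrable_mult_indicator sets.countable_UN) auto
    ultimately have "(LINT x:(\<Union>i. A i)|lborel. f x) = (\<Sum>i. LINT x:A i|lborel. f x)"
      using union(1) by (intro lebesgue_integral_countable_add) (auto simp: disjoint_family_on_def)
    then show ?case
      using union by simp
  qed (auto simp: set_lebesgue_integral_def)
qed (fact f)

text \<open>By \<open>weak_deriv_integral\<close> both candidates have the same integral over every
  subinterval, namely the increment of \<open>u\<close>.\<close>

lemma weak_deriv_unique:
  assumes "0 < l" and u: "continuous_on {0..l} u"
    and v: "integrable (lebesgue_on {0<..<l}) v" "weak_deriv l u v"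
    and w: "integrable (lebesgue_on {0<..<l}) w" "weak_deriv l u w"
  shows "AE x in lebesgue_on {0<..<l}. v x = w x"
proof -
  \<comment> \<open>Extension by zero moves the question to the whole line.\<close>
  define f where "f x = indicator {0<..<l} x * (v x - w x)" for x
  have int: "(LINT x|lebesgue_on {0<..<l}. indicator {a<..<b} x * (v x - w x)) = 0"
    if "0 \<le> a" "a < b" "b \<le> l" for a b
  proof -
    have "integrable (lebesgue_on {0<..<l}) (\<lambda>x. indicator {a<..<b} x * v x)"
         "integrable (lebesgue_on {0<..<l}) (\<lambda>x. indicator {a<..<b} x * w x)"
      using integrable_mult_indicator[OF Ioo_in_sets_lebesgue_on v(1), of a b]
        integrable_mult_indicator[OF Ioo_in_sets_lebesgue_on w(1), of a b] that
      by auto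
    then show ?thesis
      using weak_deriv_integral[OF that u v] weak_deriv_integral[OF that u w]
      by (simp add: right_diff_distrib)
  qed
  have f: "integrable lebesgue f"
    using Bochner_Integration.integrable_diff[OF v(1) w(1)]
    by (simp add: f_def[abs_def] integrable_restrict_space)
  \<comment> \<open>The Dynkin argument concerns Borel sets, whereas \<open>f\<close> is only
    Lebesgue measurable; \<open>f'\<close> is a Borel version.\<close>
  then obtain f' where f': "f' \<in> borel_measurable lborel" "AE x in lborel. f x = f' x"
    using completion_ex_borel_measurable_real[of f lborel] by auto
  then have ae: "AE x in lebesgue. f x = f' x"
    by (auto intro: AE_completion)
  have f'_meas: "f' \<in> borel_measurable lebesgue"
    using f'(1) by (rule measurable_completion)
  have "integrable lebesgue f'"
    using integrable_cong_AE[OF _ f'_meas ae] f by auto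
  then have int_f': "integrable lborel f'"
    using f'(1) by (simp add: integrable_completion)
  have eq: "(LINT x|lborel. indicator {a<..<b} x * f' x) = 0" for a b
  proof -
    have "(LINT x|lborel. indicator {a<..<b} x * f' x) = (LINT x|lebesgue. indicator {a<..<b} x * f' x)"
      using f'(1) by (subst integral_completion) auto
    also have "\<dots> = (LINT x|lebesgue. indicator {a<..<b} x * f x)"
      using f'_meas f ae
      by (intro integral_cong_AE borel_measurable_times borel_measurable_indicator) (auto elim!: AE_mp)
    also have "\<dots> = (LINT x|lebesgue. indicator {0<..<l} x *\<^sub>R (indicator {max a 0<..<min b l} x * (v x - w x)))"
      by (intro Bochner_Integration.integral_cong) (auto simp: f_def indicator_def)
    also have "\<dots> = (LINT x|lebesgue_on {0<..<l}. indicator {max a 0<..<min b l} x * (v x - w x))"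
      by (subst integral_restrict_space) auto
    also have "\<dots> = 0"
      using int[of "max a 0" "min b l"] by (cases "max a 0 < min b l") auto
    finally show ?thesis .
  qed
  have "AE x in lborel. f' x = 0"
  proof (rule AE_zero_if_interval_integrals_zero[OF int_f' _ eq])
    \<comment> \<open>\<open>f\<close> vanishes off the open edge, so the total integral is again
      one over an interval.\<close>
    have "(LINT x|lborel. f' x) = (LINT x|lborel. indicator {0<..<l} x * f' x)"
      using f' by (intro integral_cong_AE) (auto elim!: AE_mp simp: f_def indicator_def)
    then show "(LINT x|lborel. f' x) = 0"
      using eq by simp
  qed
  then have "AE x in lborel. f x = 0"
    using f'(2) by eventually_elim simp
  then have "AE x in lebesgue. f x = 0"
    by (rule AE_completion)
  then show ?thesis
    by (subst AE_restrict_space_iff) (auto elim!: AE_mp simp: f_def)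
qed

section \<open>Functions that are affine on both halves of an interval\<close>

text \<open>\<open>p\<close>, \<open>m\<close> and \<open>q\<close> are the values at 0, at the
  midpoint and at \<open>l\<close>.\<close>

definition edge_interp :: "real \<Rightarrow> real \<Rightarrow> real \<Rightarrow> real \<Rightarrow> real \<Rightarrow> real"
  where "edge_interp l p m q s =
    (if s \<le> l / 2 then p + 2 / l * (m - p) * s else m + 2 / l * (q - m) * (s - l / 2))"

text \<open>Indicators of open intervals match \<open>weak_deriv_integral\<close>; at the kink
  \<open>l / 2\<close> the value is 0 by default.\<close>

definition edge_slope :: "real \<Rightarrow> real \<Rightarrow> real \<Rightarrow> real \<Rightarrow> real \<Rightarrow> real"
  where "edge_slope l p m q s =
    2 / l * (m - p) * indicator {0<..<l / 2} s + 2 / l * (q - m) * indicator {l / 2<..<l} s"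

lemma edge_interp_simps:
  assumes "0 < l"
  shows "edge_interp l p m q 0 = p" "edge_interp l p m q (l / 2) = m" "edge_interp l p m q l = q"
  using assms by (auto simp: edge_interp_def field_simps)

lemma continuous_on_edge_interp:
  assumes "0 < l"
  shows "continuous_on {0..l} (edge_interp l p m q)"
proof -
  have "continuous_on ({0..l / 2} \<union> {l / 2..l}) (edge_interp l p m q)"
    unfolding edge_interp_def[abs_def]
    using assms by (intro continuous_on_If continuous_intros) (auto simp: field_simps)
  then show ?thesis
    using assms by (simp add: ivl_disj_un)
qed

lemma has_derivative_edge_interp:
  assumes "s \<in> {0<..<l} - {l / 2}"
  shows "(edge_interp l p m q has_real_derivative edge_slope l p m q s) (at s)"
proof (cases "s < l / 2")
  case True
  then have "((\<lambda>s. p + 2 / l * (m - p) * s) has_real_derivative edge_slope l p m q s) (at s)"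
    using assms by (auto simp: edge_slope_def intro!: derivative_eq_intros)
  then show ?thesis
    by (rule has_field_derivative_transform_within_open[of _ _ _ "{..<l / 2}"])
      (use True in \<open>auto simp: edge_interp_def\<close>)
next
  case False
  then have "((\<lambda>s. m + 2 / l * (q - m) * (s - l / 2)) has_real_derivative edge_slope l p m q s) (at s)"
    using assms by (auto simp: edge_slope_def intro!: derivative_eq_intros)
  then show ?thesis
    by (rule has_field_derivative_transform_within_open[of _ _ _ "{l / 2<..}"])
      (use False assms in \<open>auto simp: edge_interp_def\<close>)
qed

lemma integrable_indicator_Ioo_mult:
  fixes v :: "real \<Rightarrow> real"
  assumes "integrable (lebesgue_on {0<..<l}) v" "0 \<le> a" "b \<le> l"
  shows "integrable (lebesgue_on {0<..<l}) (\<lambda>s. indicator {a<..<b} s * v s)"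
  using integrable_mult_indicator[OF Ioo_in_sets_lebesgue_on assms(1)] assms by simp

lemma integrable_edge_slope_mult:
  assumes "0 < l" and v: "integrable (lebesgue_on {0<..<l}) v"
  shows "integrable (lebesgue_on {0<..<l}) (\<lambda>s. edge_slope l p m q s * v s)"
proof -
  have "integrable (lebesgue_on {0<..<l}) (\<lambda>s. 2 / l * (m - p) * (indicator {0<..<l / 2} s * v s) +
      2 / l * (q - m) * (indicator {l / 2<..<l} s * v s))"
    using assms
    by (intro Bochner_Integration.integrable_add integrable_mult_right integrable_indicator_Ioo_mult) auto
  then show ?thesis
    by (simp add: edge_slope_def distrib_right mult.assoc)
qed

text \<open>The slope is constant on each half, so \<open>v\<close> enters only through the
  increments of \<open>u\<close> there. This is what reduces the Dirichlet form to a finite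
  network.\<close>

lemma integral_edge_slope_mult:
  assumes "0 < l" and u: "continuous_on {0..l} u"
    and v: "integrable (lebesgue_on {0<..<l}) v" "weak_deriv l u v"
  shows "(LINT s|lebesgue_on {0<..<l}. edge_slope l p m q s * v s) =
    2 / l * ((m - p) * (u (l / 2) - u 0)) + 2 / l * ((q - m) * (u l - u (l / 2)))"
proof -
  let ?M = "lebesgue_on {0<..<l}"
  have "(LINT s|?M. edge_slope l p m q s * v s) =
      (LINT s|?M. 2 / l * (m - p) * (indicator {0<..<l / 2} s * v s) +
        2 / l * (q - m) * (indicator {l / 2<..<l} s * v s))"
    by (simp add: edge_slope_def distrib_right mult.assoc)
  also have "\<dots> = (LINT s|?M. 2 / l * (m - p) * (indicator {0<..<l / 2} s * v s)) +
      (LINT s|?M. 2 / l * (q - m) * (indicator {l / 2<..<l} s * v s))"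
    using assms
    by (intro Bochner_Integration.integral_add integrable_mult_right integrable_indicator_Ioo_mult) auto
  also have "\<dots> = 2 / l * (m - p) * (u (l / 2) - u 0) + 2 / l * (q - m) * (u l - u (l / 2))"
    using weak_deriv_integral[OF _ _ _ u v, of 0 "l / 2"] weak_deriv_integral[OF _ _ _ u v, of "l / 2" l] \<open>0 < l\<close>
    by simp
  finally show ?thesis
    by (simp only: mult.assoc)
qed

lemma L2_interval_continuous:
  assumes "continuous_on {0..l} u"
  shows "L2_interval l u"
  unfolding L2_interval_def
  using integrable_Ioo_continuous(1)[OF assms] integrable_Ioo_continuous(1)[OF continuous_on_power[OF assms]]
  by auto

lemma L2_interval_edge_slope:
  assumes "0 < l"
  shows "L2_interval l (edge_slope l p m q)"
proof -
  have "integrable (lebesgue_on {0<..<l}) (\<lambda>s. edge_slope l p m q s * 1)"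
    using assms by (intro integrable_edge_slope_mult integrable_Ioo_continuous) auto
  then have *: "integrable (lebesgue_on {0<..<l}) (edge_slope l p m q)" by simp
  moreover have "integrable (lebesgue_on {0<..<l}) (\<lambda>s. edge_slope l p m q s * edge_slope l p m q s)"
    using assms * by (rule integrable_edge_slope_mult)
  ultimately show ?thesis
    by (auto simp: L2_interval_def power2_eq_square)
qed

text \<open>Integration by parts, with the kink as the exceptional point of the fundamental theorem;
  the boundary terms vanish because a test function is 0 at both ends.\<close>

lemma weak_deriv_edge_interp:
  assumes "0 < l"
  shows "weak_deriv l (edge_interp l p m q) (edge_slope l p m q)"
  unfolding weak_deriv_def
proof (intro allI impI)
  fix \<phi> :: "real \<Rightarrow> real" assume "test_fun l \<phi>"
  then obtain D K where D: "\<And>x. (\<phi> has_real_derivative D x) (at x)" "continuous_on UNIV D"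
    and K: "K \<subseteq> {0<..<l}" "\<And>x. x \<notin> K \<Longrightarrow> \<phi> x = 0"
    by (auto simp: test_fun_def C1_differentiable_on_def has_real_derivative_iff_has_vector_derivative)
  have deriv: "deriv \<phi> = D"
    using D(1) by (auto intro!: DERIV_imp_deriv)
  have \<phi>: "\<phi> 0 = 0" "\<phi> l = 0" "continuous_on S \<phi>" for S
    using K(1) by (auto intro!: K(2) continuous_at_imp_continuous_on DERIV_isCont[OF D(1)])
  let ?M = "lebesgue_on {0<..<l}" and ?u = "edge_interp l p m q" and ?v = "edge_slope l p m q"
  have int: "integrable ?M (\<lambda>x. ?u x * D x)" "integrable ?M (\<lambda>x. ?v x * \<phi> x)"
    by (intro integrable_Ioo_continuous continuous_intros continuous_on_edge_interp assms
        integrable_edge_slope_mult \<phi> continuous_on_subset[OF D(2)] subset_UNIV)+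
  have "((\<lambda>x. ?u x * D x + ?v x * \<phi> x) has_integral ?u l * \<phi> l - ?u 0 * \<phi> 0) {0..l}"
  proof (rule fundamental_theorem_of_calculus_interior_strong)
    show "finite {l / 2}" "0 \<le> l" using assms by auto
    show "continuous_on {0..l} (\<lambda>x. ?u x * \<phi> x)"
      by (intro continuous_intros continuous_on_edge_interp assms \<phi>)
    fix x assume "x \<in> {0<..<l} - {l / 2}"
    from DERIV_mult[OF has_derivative_edge_interp[OF this] D(1)]
    show "((\<lambda>x. ?u x * \<phi> x) has_vector_derivative ?u x * D x + ?v x * \<phi> x) (at x)"
      by (simp add: has_real_derivative_iff_has_vector_derivative add.commute mult.commute)
  qed
  then have "integral {0..l} (\<lambda>x. ?u x * D x + ?v x * \<phi> x) = 0"
    by (simp add: \<phi> integral_unique)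
  then have "(LINT x|?M. ?u x * D x + ?v x * \<phi> x) = 0"
    using Bochner_Integration.integrable_add[OF int]
    by (subst lebesgue_integral_eq_integral) (simp_all add: integral_open_interval_real)
  then show "(LINT x|?M. ?u x * deriv \<phi> x) = - (LINT x|?M. ?v x * \<phi> x)"
    using int by (simp add: deriv)
qed

section \<open>Piecewise affine functions on a metric graph\<close>

text \<open>Reads \<open>w\<close> only at vertices and midpoints, so node potentials can be given
  as functions on all points.\<close>

fun pw_affine :: "('v, 'e) pre_digraph \<Rightarrow> ('e \<Rightarrow> real) \<Rightarrow> (('v, 'e) point \<Rightarrow> real) \<Rightarrow> ('v, 'e) point \<Rightarrow> real"
  where
    "pw_affine G len w (Vertex v) = w (Vertex v)"
  | "pw_affine G len w (Inner e s) =
      edge_interp (len e) (w (Vertex (tail G e))) (w (Inner e (len e / 2))) (w (Vertex (head G e))) s"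

definition nodes :: "('v, 'e) pre_digraph \<Rightarrow> ('e \<Rightarrow> real) \<Rightarrow> ('v, 'e) point set"
  where "nodes G len = Vertex ` verts G \<union> (\<lambda>e. Inner e (len e / 2)) ` arcs G"

text \<open>The two halves of every edge, as edges of a network on the vertices and the midpoints.\<close>

definition half_edges :: "('v, 'e) pre_digraph \<Rightarrow> ('e \<times> bool) set"
  where "half_edges G = arcs G \<times> UNIV"

text \<open>\<open>True\<close> marks the half at the tail, \<open>False\<close> the half at the
  head.\<close>

definition half_source :: "('v, 'e) pre_digraph \<Rightarrow> ('e \<Rightarrow> real) \<Rightarrow> 'e \<times> bool \<Rightarrow> ('v, 'e) point"
  where "half_source G len = (\<lambda>(e, b). if b then Vertex (tail G e) else Inner e (len e / 2))"

definition half_target :: "('v, 'e) pre_digraph \<Rightarrow> ('e \<Rightarrow> real) \<Rightarrow> 'e \<times> bool \<Rightarrow> ('v, 'e) point"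
  where "half_target G len = (\<lambda>(e, b). if b then Inner e (len e / 2) else Vertex (head G e))"

text \<open>A half-edge has length \<open>len e / 2\<close>, hence conductance
  \<open>2 / len e\<close>.\<close>

abbreviation graph_form :: "('v, 'e) pre_digraph \<Rightarrow> ('e \<Rightarrow> real) \<Rightarrow>
    (('v, 'e) point \<Rightarrow> real) \<Rightarrow> (('v, 'e) point \<Rightarrow> real) \<Rightarrow> real"
  where "graph_form G len \<equiv>
    network_form (half_edges G) (\<lambda>(e, b). 2 / len e) (half_source G len) (half_target G len)"

lemma graph_form_eq:
  "graph_form G len u g = (\<Sum>e\<in>arcs G.
     2 / len e * ((u (Inner e (len e / 2)) - u (Vertex (tail G e))) *
        (g (Inner e (len e / 2)) - g (Vertex (tail G e)))) +
     2 / len e * ((u (Vertex (head G e)) - u (Inner e (len e / 2))) *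
        (g (Vertex (head G e)) - g (Inner e (len e / 2)))))"
  unfolding network_form_def half_edges_def
  by (simp add: sum.cartesian_product' UNIV_bool half_source_def half_target_def add.commute)

context metric_graph
begin

lemma pw_affine_chart:
  assumes "e \<in> arcs G"
  shows "pw_affine G len w (chart G len e s) =
    edge_interp (len e) (w (Vertex (tail G e))) (w (Inner e (len e / 2))) (w (Vertex (head G e))) s"
  using len_pos[OF assms] by (auto simp: chart_def edge_interp_simps)

lemma pw_affine_node: "a \<in> nodes G len \<Longrightarrow> pw_affine G len w a = w a"
  using len_pos by (auto simp: nodes_def edge_interp_simps)

text \<open>The universal property of the quotient, followed by that of the disjoint sum.\<close>

lemma continuous_map_mg_topology_iff:
  "continuous_map (mg_topology G len) euclideanreal f \<longleftrightarrow>
    (\<forall>e\<in>arcs G. continuous_on {0..len e} (\<lambda>s. f (chart G len e s)))"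
proof -
  let ?g = "f \<circ> case_prod (chart G len)"
  have "continuous_map (mg_topology G len) euclideanreal f \<longleftrightarrow>
      continuous_map (edge_space G len) euclideanreal ?g"
    by (rule continuous_compose_quotient_map_eq[OF quotient_map_chart, symmetric])
  also have "\<dots> \<longleftrightarrow> (\<forall>e\<in>arcs G. continuous_map (top_of_set {0..len e}) euclideanreal (\<lambda>s. ?g (e, s)))"
    unfolding edge_space_def
  proof (intro iffI ballI)
    fix e assume "continuous_map (sum_topology (\<lambda>e. top_of_set {0..len e}) (arcs G)) euclideanreal ?g" "e \<in> arcs G"
    from continuous_map_compose[OF continuous_map_component_injection[OF this(2)] this(1)]
    show "continuous_map (top_of_set {0..len e}) euclideanreal (\<lambda>s. ?g (e, s))"
      by (simp add: o_def)
  next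
    assume "\<forall>e\<in>arcs G. continuous_map (top_of_set {0..len e}) euclideanreal (\<lambda>s. ?g (e, s))"
    then show "continuous_map (sum_topology (\<lambda>e. top_of_set {0..len e}) (arcs G)) euclideanreal ?g"
      by (auto simp: continuous_map_def openin_sum_topology)
  qed
  finally show ?thesis
    by (simp add: continuous_map_iff_continuous)
qed

lemma edge_deriv_spec:
  assumes "f \<in> H1 G len" "e \<in> arcs G"
  shows "L2_interval (len e) (edge_deriv G len f e)"
    and "weak_deriv (len e) (\<lambda>x. f (chart G len e x)) (edge_deriv G len f e)"
proof -
  have "\<exists>v. L2_interval (len e) v \<and> weak_deriv (len e) (\<lambda>x. f (chart G len e x)) v"
    using assms by (auto simp: H1_def H1_interval_def)
  from someI_ex[OF this] show "L2_interval (len e) (edge_deriv G len f e)"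
    and "weak_deriv (len e) (\<lambda>x. f (chart G len e x)) (edge_deriv G len f e)"
    by (simp_all add: edge_deriv_def)
qed

lemma pw_affine_in_H1: "pw_affine G len w \<in> H1 G len"
  unfolding H1_def continuous_map_mg_topology_iff H1_interval_def
  using len_pos
  by (auto simp: pw_affine_chart
      intro!: continuous_on_edge_interp L2_interval_continuous[OF continuous_on_edge_interp]
        exI[of _ "edge_slope _ _ _ _"] weak_deriv_edge_interp L2_interval_edge_slope)

text \<open>\<open>edge_deriv\<close> is an unspecified choice, but uniqueness almost everywhere
  allows replacing it by \<open>edge_slope\<close>; what remains of an arbitrary \<open>g\<close>
  are its values at the nodes.\<close>

lemma dirichlet_form_pw_affine:
  assumes g: "g \<in> H1 G len"
  shows "dirichlet_form G len (pw_affine G len w) g = graph_form G len w g"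
  unfolding dirichlet_form_def graph_form_eq
proof (rule sum.cong)
  fix e assume e: "e \<in> arcs G"
  let ?l = "len e"
  let ?M = "lebesgue_on {0<..<?l}" and ?g = "\<lambda>x. g (chart G len e x)" and ?Dg = "edge_deriv G len g e"
  let ?p = "w (Vertex (tail G e))" and ?m = "w (Inner e (len e / 2))" and ?q = "w (Vertex (head G e))"
  have l: "0 < ?l" by (rule len_pos[OF e])
  have Dg: "integrable ?M ?Dg" "weak_deriv ?l ?g ?Dg"
    using edge_deriv_spec[OF g e] L2_interval_integrable by auto
  have Dw: "integrable ?M (edge_deriv G len (pw_affine G len w) e)"
      "weak_deriv ?l (edge_interp ?l ?p ?m ?q) (edge_deriv G len (pw_affine G len w) e)"
    using edge_deriv_spec[OF pw_affine_in_H1 e] L2_interval_integrable by (auto simp: pw_affine_chart[OF e])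
  have slope: "integrable ?M (edge_slope ?l ?p ?m ?q)"
    by (intro L2_interval_integrable L2_interval_edge_slope l)
  have "AE x in ?M. edge_deriv G len (pw_affine G len w) e x = edge_slope ?l ?p ?m ?q x"
    by (rule weak_deriv_unique[OF l continuous_on_edge_interp[OF l] Dw slope weak_deriv_edge_interp[OF l]])
  then have "(LINT x|?M. edge_deriv G len (pw_affine G len w) e x * ?Dg x) =
      (LINT x|?M. edge_slope ?l ?p ?m ?q x * ?Dg x)"
    using Dg(1) Dw(1) slope by (intro integral_cong_AE) (auto elim!: AE_mp)
  also have "\<dots> = 2 / ?l * ((?m - ?p) * (?g (?l / 2) - ?g 0)) + 2 / ?l * ((?q - ?m) * (?g ?l - ?g (?l / 2)))"
    using g e by (intro integral_edge_slope_mult l Dg) (auto simp: H1_def continuous_map_mg_topology_iff)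
  finally show "(LINT x|?M. edge_deriv G len (pw_affine G len w) e x * ?Dg x) =
      2 / ?l * ((?m - ?p) * (g (Inner e (?l / 2)) - g (Vertex (tail G e)))) +
      2 / ?l * ((?q - ?m) * (g (Vertex (head G e)) - g (Inner e (?l / 2))))"
    using l by (simp add: chart_def)
qed simp

end

section \<open>Two-point measures\<close>

text \<open>The average of the point masses at \<open>a\<close> and \<open>b\<close>, as the law of
  a fair coin toss.\<close>

definition two_point_measure :: "('v, 'e) pre_digraph \<Rightarrow> ('e \<Rightarrow> real) \<Rightarrow>
    ('v, 'e) point \<Rightarrow> ('v, 'e) point \<Rightarrow> ('v, 'e) point measure"
  where "two_point_measure G len a b =
    distr (measure_pmf (bernoulli_pmf (1 / 2))) (mg_borel G len) (\<lambda>x. if x then a else b)"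

lemma space_mg_borel: "space (mg_borel G len) = points G len"
  and sets_mg_borel: "sets (mg_borel G len) = sigma_sets (points G len) {U. openin (mg_topology G len) U}"
proof -
  have "{U. openin (mg_topology G len) U} \<subseteq> Pow (points G len)"
    using openin_subset by fastforce
  then show "space (mg_borel G len) = points G len"
    and "sets (mg_borel G len) = sigma_sets (points G len) {U. openin (mg_topology G len) U}"
    by (simp_all add: mg_borel_def)
qed

lemma borel_measurable_mg_borel:
  assumes "continuous_map (mg_topology G len) euclideanreal f"
  shows "f \<in> borel_measurable (mg_borel G len)"
proof (rule borel_measurableI)
  fix S :: "real set" assume "open S"
  then have "openin (mg_topology G len) {x \<in> points G len. f x \<in> S}"
    using openin_continuous_map_preimage[OF assms, of S] by simp
  moreover have "f -` S \<inter> space (mg_borel G len) = {x \<in> points G len. f x \<in> S}"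
    by (auto simp: space_mg_borel)
  ultimately show "f -` S \<inter> space (mg_borel G len) \<in> sets (mg_borel G len)"
    by (auto simp: sets_mg_borel)
qed

context
  fixes G :: "('v, 'e) pre_digraph" and len :: "'e \<Rightarrow> real" and a b :: "('v, 'e) point"
  assumes ab: "a \<in> points G len" "b \<in> points G len"
begin

lemma measurable_two_point:
  "(\<lambda>x. if x then a else b) \<in> measurable (measure_pmf (bernoulli_pmf (1 / 2))) (mg_borel G len)"
  using ab by (auto simp: space_mg_borel)

lemma two_point_measure_borel_prob: "two_point_measure G len a b \<in> borel_prob_measures G len"
  unfolding borel_prob_measures_def two_point_measure_def
  using prob_space.prob_space_distr[OF measure_pmf.prob_space_axioms measurable_two_point] by simp

lemma integral_two_point_measure:
  fixes f :: "('v, 'e) point \<Rightarrow> real"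
  assumes "f \<in> borel_measurable (mg_borel G len)"
  shows "(LINT x|two_point_measure G len a b. f x) = (f a + f b) / 2"
  unfolding two_point_measure_def
  by (subst integral_distr[OF measurable_two_point assms]) simp

lemma integrable_two_point_measure:
  fixes f :: "('v, 'e) point \<Rightarrow> real"
  assumes "f \<in> borel_measurable (mg_borel G len)"
  shows "integrable (two_point_measure G len a b) f"
  unfolding two_point_measure_def
  by (subst integrable_distr_eq[OF measurable_two_point assms]) (auto intro: integrable_measure_pmf_finite)

lemma AE_two_point_measureD:
  assumes "AE x in two_point_measure G len a b. P x"
  shows "P a" "P b"
proof -
  have "P (if x then a else b)" for x
    using AE_distrD[OF measurable_two_point assms[unfolded two_point_measure_def]]
    by (simp add: AE_measure_pmf_iff)
  from this[of True] this[of False] show "P a" "P b" by simp_all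
qed

text \<open>Every neighbourhood of \<open>a\<close> or \<open>b\<close> catches an outcome of the
  coin. In the harmonicity condition this forces the test functions to vanish at both
  points.\<close>

lemma msupp_two_point_measure: "{a, b} \<subseteq> msupp G len (two_point_measure G len a b)"
proof -
  have "0 < emeasure (two_point_measure G len a b) U"
    if "openin (mg_topology G len) U" "c \<in> U" "c \<in> {a, b}" for U c
  proof -
    have U: "U \<in> sets (mg_borel G len)"
      using that by (auto simp: sets_mg_borel)
    have "emeasure (two_point_measure G len a b) U =
        emeasure (measure_pmf (bernoulli_pmf (1 / 2))) ((\<lambda>x. if x then a else b) -` U)"
      unfolding two_point_measure_def by (simp add: emeasure_distr[OF measurable_two_point U])
    moreover obtain x where x: "{x} \<subseteq> (\<lambda>x. if x then a else b) -` U"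
    proof (cases "c = a")
      case True
      then show ?thesis using that[of True] \<open>c \<in> U\<close> by simp
    next
      case False
      then show ?thesis using that[of False] \<open>c \<in> U\<close> \<open>c \<in> {a, b}\<close> by simp
    qed
    moreover have "0 < emeasure (measure_pmf (bernoulli_pmf (1 / 2))) {x}"
      by (simp only: emeasure_pmf_single pmf_bernoulli_half ennreal_less_zero_iff half_gt_zero_iff zero_less_one)
    moreover have "emeasure (measure_pmf (bernoulli_pmf (1 / 2))) {x} \<le>
        emeasure (measure_pmf (bernoulli_pmf (1 / 2))) ((\<lambda>x. if x then a else b) -` U)"
      using x by (rule emeasure_mono) simp
    ultimately show ?thesis
      by simp
  qed
  then show ?thesis
    using ab by (auto simp: msupp_def)
qed

end

lemma (in metric_graph) nodes_subset_points: "nodes G len \<subseteq> points G len"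
proof -
  have "Inner e (len e / 2) \<in> points G len" if "e \<in> arcs G" for e
  proof -
    have "(e, len e / 2) \<in> topspace (edge_space G len)" "chart G len e (len e / 2) = Inner e (len e / 2)"
      using that len_pos[OF that] by (auto simp: edge_space_def chart_def)
    then show ?thesis
      unfolding points_def by (metis (mono_tags, lifting) case_prod_conv image_eqI)
  qed
  then show ?thesis
    using Vertex_in_points by (auto simp: nodes_def)
qed

section \<open>Eigenfunctions of two-point measures\<close>

lemma eig_mult_ge:
  assumes "lin_indep_AE \<mu> n f" "\<And>i. i < n \<Longrightarrow> op_graph G len \<mu> (f i) (\<lambda>x. t * f i x)"
  shows "enat n \<le> eig_mult G len \<mu> t"
  unfolding eig_mult_def using assms by (intro SUP_upper) auto

context metric_graph
begin

text \<open>The identity assumed for \<open>h\<close> is the weak eigenvalue equation on the network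
  with mass 1 / 2 at \<open>a\<close> and at \<open>b\<close>. For \<open>g\<close> vanishing at
  both points it yields harmonicity off the support, for general \<open>g\<close> the equation of
  the operator.\<close>

lemma op_graph_two_point_measure:
  assumes ab: "a \<in> nodes G len" "b \<in> nodes G len"
    and h: "\<And>g. graph_form G len h g = t * ((h a * g a + h b * g b) / 2)"
  shows "op_graph G len (two_point_measure G len a b) (pw_affine G len h) (\<lambda>x. t * pw_affine G len h x)"
proof -
  let ?\<mu> = "two_point_measure G len a b" and ?f = "pw_affine G len h"
  have ab': "a \<in> points G len" "b \<in> points G len"
    using ab nodes_subset_points by auto
  have borel: "g \<in> borel_measurable (mg_borel G len)" if "g \<in> H1 G len" for g
    using that by (intro borel_measurable_mg_borel) (simp add: H1_def)
  note f = pw_affine_in_H1[of h] and [measurable] = borel[OF pw_affine_in_H1[of h]]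
  have "harmonic_on G len (points G len - msupp G len ?\<mu>) ?f"
    unfolding harmonic_on_def
  proof (intro conjI ballI impI f)
    fix g assume g: "g \<in> H1 G len" "\<forall>x\<in>points G len - (points G len - msupp G len ?\<mu>). g x = 0"
    then have "g a = 0" "g b = 0"
      using msupp_two_point_measure[OF ab'] ab' by auto
    then show "dirichlet_form G len ?f g = 0"
      by (simp add: dirichlet_form_pw_affine[OF g(1)] h)
  qed
  moreover have "dirichlet_form G len ?f \<phi> = (LINT x|?\<mu>. t * ?f x * \<phi> x)" if "\<phi> \<in> H1 G len" for \<phi>
  proof -
    note [measurable] = borel[OF that]
    have "(LINT x|?\<mu>. t * ?f x * \<phi> x) = (t * ?f a * \<phi> a + t * ?f b * \<phi> b) / 2"
      by (rule integral_two_point_measure[OF ab']) measurable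
    then show ?thesis
      by (simp add: dirichlet_form_pw_affine[OF that] h pw_affine_node ab algebra_simps)
  qed
  moreover have "integrable ?\<mu> (\<lambda>x. (t * ?f x)\<^sup>2)"
    by (rule integrable_two_point_measure[OF ab']) measurable
  moreover have "(\<lambda>x. t * ?f x) \<in> borel_measurable ?\<mu>"
    unfolding two_point_measure_def by simp
  ultimately show ?thesis
    using f by (auto simp: op_graph_def H1_measure_def)
qed

text \<open>The potential between \<open>a\<close> and \<open>b\<close>, shifted to mean zero, is an eigenfunction of the two-point
  measure; its eigenvalue is four times the effective conductance.\<close>

lemma eigval_min_le_graph_form:
  assumes ab: "a \<in> nodes G len" "b \<in> nodes G len" "a \<noteq> b" and w: "w a = 1" "w b = 0"
  shows "eigval_min G len 1 \<le> ereal (4 * graph_form G len w w)"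
proof -
  have c: "0 \<le> (\<lambda>(e, b). 2 / len e) i" if "i \<in> half_edges G" for i
    using that less_imp_le[OF len_pos] by (auto simp: half_edges_def)
  obtain u where u: "u a = 1" "u b = 0"
    and min: "\<forall>w. w a = 1 \<longrightarrow> w b = 0 \<longrightarrow> graph_form G len u u \<le> graph_form G len w w"
    using network_minimizer_exists[where I = "half_edges G" and c = "\<lambda>(e, b). 2 / len e"
        and p = "half_source G len" and q = "half_target G len", OF c ab(3)]
    by blast
  define C where "C = graph_form G len u u"
  define \<mu> where "\<mu> = two_point_measure G len a b"
  have "0 \<le> C"
    unfolding C_def network_form_def by (intro sum_nonneg mult_nonneg_nonneg[OF c zero_le_square])
  have ab': "a \<in> points G len" "b \<in> points G len"
    using ab nodes_subset_points by auto
  \<comment> \<open>\<open>f 0\<close> is the constant 1, with eigenvalue 0; the shift gives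
    \<open>f 1\<close> the values 1 / 2 and - 1 / 2 at \<open>a\<close> and
    \<open>b\<close>.\<close>
  define f where "f = (\<lambda>i :: nat. pw_affine G len (if i = 0 then (\<lambda>_. 1) else (\<lambda>x. u x - 1 / 2)))"
  have f_ab: "f 0 a = 1" "f 0 b = 1" "f (Suc 0) a = 1 / 2" "f (Suc 0) b = - 1 / 2"
    by (simp_all add: f_def pw_affine_node ab u)
  have f0: "op_graph G len \<mu> (f 0) (\<lambda>x. 0 * f 0 x)"
    unfolding \<mu>_def f_def using ab
    by (intro op_graph_two_point_measure) (auto simp: network_form_def)
  have f1: "op_graph G len \<mu> (f (Suc 0)) (\<lambda>x. 4 * C * f (Suc 0) x)"
    unfolding \<mu>_def f_def if_not_P[OF nat.distinct(2)]
  proof (rule op_graph_two_point_measure[OF ab(1,2)])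
    fix g
    have "graph_form G len (\<lambda>x. u x - 1 / 2) g = graph_form G len u g"
      by (simp add: network_form_def)
    also have "\<dots> = C * (g a - g b)"
      unfolding C_def by (rule network_green[where c = "\<lambda>(e, b). 2 / len e", OF c u min[rule_format]])
    \<comment> \<open>The factor 4 compensates the masses 1 / 2 and the values 1 / 2 and - 1 /
      2.\<close>
    finally show "graph_form G len (\<lambda>x. u x - 1 / 2) g =
        4 * C * (((u a - 1 / 2) * g a + (u b - 1 / 2) * g b) / 2)"
      by (simp add: u algebra_simps)
  qed
  \<comment> \<open>Index 1 requires total multiplicity at least 2 among the eigenvalues up to
    \<open>4 * C\<close>. If \<open>C = 0\<close>, the eigenvalue 0 has to supply both; otherwise 0
    and \<open>4 * C\<close> are distinct and supply at least 1 each.\<close>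
  have "\<exists>S. finite S \<and> S \<subseteq> {..4 * C} \<and> enat 1 < (\<Sum>s\<in>S. eig_mult G len \<mu> s)"
  proof (cases "C = 0")
    case True
    have "lin_indep_AE \<mu> 2 f"
      unfolding lin_indep_AE_def
    proof (intro allI impI)
      fix c :: "nat \<Rightarrow> real" and i :: nat
      assume AE: "AE x in \<mu>. (\<Sum>i<2. c i * f i x) = 0" and "i < 2"
      \<comment> \<open>Evaluation at the atoms gives \<open>c 0 + c (Suc 0) / 2 = 0\<close> and
        \<open>c 0 - c (Suc 0) / 2 = 0\<close>.\<close>
      have "c 0 = 0 \<and> c (Suc 0) = 0"
        using AE_two_point_measureD[OF ab' AE[unfolded \<mu>_def]] by (simp add: numeral_2_eq_2 f_ab)
      then show "c i = 0"
        using \<open>i < 2\<close> by (auto simp: less_2_cases_iff)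
    qed
    then have "enat 2 \<le> eig_mult G len \<mu> 0"
      by (rule eig_mult_ge) (use f0 f1 True in \<open>auto simp: less_2_cases_iff\<close>)
    then have "enat 1 < eig_mult G len \<mu> 0"
      by (rule less_le_trans[rotated]) simp
    then show ?thesis
      using True by (intro exI[of _ "{0}"]) simp
  next
    case False
    have single: "enat 1 \<le> eig_mult G len \<mu> t"
      if "op_graph G len \<mu> g (\<lambda>x. t * g x)" "g a \<noteq> 0" for g t
    proof (rule eig_mult_ge)
      show "lin_indep_AE \<mu> 1 (\<lambda>i. g)"
        unfolding lin_indep_AE_def
      proof (intro allI impI)
        fix c :: "nat \<Rightarrow> real" and i :: nat
        assume AE: "AE x in \<mu>. (\<Sum>i<1. c i * g x) = 0" and "i < 1"
        then show "c i = 0"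
          using AE_two_point_measureD(1)[OF ab' AE[unfolded \<mu>_def]] that(2) by simp
      qed
    qed (use that in auto)
    have "enat 1 < enat 1 + enat 1"
      by simp
    also have "\<dots> \<le> eig_mult G len \<mu> 0 + eig_mult G len \<mu> (4 * C)"
      by (intro add_mono single[OF f0] single[OF f1]) (simp_all add: f_ab)
    finally have "enat 1 < (\<Sum>s\<in>{0, 4 * C}. eig_mult G len \<mu> s)"
      using False by simp
    then show ?thesis
      using \<open>0 \<le> C\<close> by (intro exI[of _ "{0, 4 * C}"]) simp
  qed
  then have "eigval G len \<mu> 1 \<le> ereal (4 * C)"
    unfolding eigval_def by (intro INF_lower) simp
  then have "eigval_min G len 1 \<le> ereal (4 * C)"
    unfolding eigval_min_def
    using two_point_measure_borel_prob[OF ab'] by (intro INF_lower2[of \<mu>]) (simp_all add: \<mu>_def)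
  also have "\<dots> \<le> ereal (4 * graph_form G len w w)"
    unfolding C_def using min[rule_format, OF w] by simp
  finally show ?thesis .
qed

end

section \<open>Test functions for the Cheeger-type constant\<close>

context metric_graph
begin

lemma eigval_min_le_edge_boundary:
  assumes Y: "Y \<noteq> {}" "Y \<subset> verts G"
  shows "eigval_min G len 1 \<le> ereal (4 * (\<Sum>e\<in>edge_boundary G Y. 1 / len e))"
proof -
  obtain a b where ab: "a \<in> Y" "b \<in> verts G" "b \<notin> Y"
    using Y by auto
  \<comment> \<open>With the mean value at midpoints, each half of a boundary edge has increment 1 /
    2 up to sign and energy \<open>2 / len e * (1 / 4)\<close>, so the edge contributes
    \<open>1 / len e\<close>; all other edges contribute 0.\<close>
  define w :: "('v, 'e) point \<Rightarrow> real" where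
    "w x = (case x of Vertex v \<Rightarrow> of_bool (v \<in> Y)
       | Inner e s \<Rightarrow> (of_bool (tail G e \<in> Y) + of_bool (head G e \<in> Y)) / 2)" for x
  have "eigval_min G len 1 \<le> ereal (4 * graph_form G len w w)"
    by (rule eigval_min_le_graph_form[of "Vertex a" "Vertex b"]) (use ab Y in \<open>auto simp: nodes_def w_def\<close>)
  also have "graph_form G len w w = (\<Sum>e\<in>arcs G. if e \<in> edge_boundary G Y then 1 / len e else 0)"
    unfolding graph_form_eq
    by (rule sum.cong) (auto simp: w_def edge_boundary_def of_bool_def field_simps)
  also have "\<dots> = (\<Sum>e\<in>edge_boundary G Y. 1 / len e)"
    by (subst sum.inter_restrict[symmetric]) (auto intro!: sum.cong simp: edge_boundary_def)
  finally show ?thesis .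
qed

text \<open>Off the two midpoints the test function is constant, with the value minimizing its energy.\<close>

lemma eigval_min_le_two_edges:
  assumes e: "e1 \<in> arcs G" "e2 \<in> arcs G" "e1 \<noteq> e2"
  shows "eigval_min G len 1 \<le> ereal (4 * (1 / len e1 + 1 / len e2))"
proof -
  let ?a = "len e1" and ?b = "len e2"
  have pos: "0 < ?a" "0 < ?b"
    using e len_pos by auto
  \<comment> \<open>Two half-edges in parallel join each midpoint to the constant part, with
    conductances \<open>4 / ?a\<close> and \<open>4 / ?b\<close>; \<open>c\<close> is the potential
    between these in series, and \<open>4 / (?a + ?b)\<close> is their joint conductance.\<close>
  define c where "c = ?b / (?a + ?b)"
  define w :: "('v, 'e) point \<Rightarrow> real" where
    "w x = (if x = Inner e1 (?a / 2) then 1 else if x = Inner e2 (?b / 2) then 0 else c)" for x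
  have "graph_form G len w w =
      (\<Sum>e\<in>arcs G. (if e = e1 then 4 / ?a * (1 - c)\<^sup>2 else 0) + (if e = e2 then 4 / ?b * c\<^sup>2 else 0))"
    unfolding graph_form_eq using e(3)
    by (intro sum.cong) (auto simp: w_def power2_eq_square algebra_simps add_divide_distrib)
  also have "\<dots> = 4 / ?a * (1 - c)\<^sup>2 + 4 / ?b * c\<^sup>2"
    using e by (simp add: sum.distrib)
  also have "\<dots> = 4 / (?a + ?b)"
  proof -
    define s where "s = ?a + ?b"
    have "1 - c = ?a / s" "c = ?b / s"
      using pos by (simp_all add: s_def c_def field_simps)
    then have "4 / ?a * (1 - c)\<^sup>2 + 4 / ?b * c\<^sup>2 = 4 * ?a / s\<^sup>2 + 4 * ?b / s\<^sup>2"
      using pos by (simp add: power2_eq_square)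
    also have "\<dots> = 4 * s / s\<^sup>2"
      by (simp add: s_def add_divide_distrib)
    also have "\<dots> = 4 / s"
      by (simp add: power2_eq_square)
    finally show ?thesis
      by (simp only: s_def)
  qed
  \<comment> \<open>The inequality between harmonic and arithmetic mean, obtained from a
    square.\<close>
  also have "\<dots> \<le> 1 / ?a + 1 / ?b"
  proof -
    have "0 \<le> (?a - ?b)\<^sup>2" by simp
    then have "4 * (?a * ?b) \<le> (?a + ?b) * (?a + ?b)"
      by (simp add: power2_eq_square algebra_simps)
    then have "4 / (?a + ?b) \<le> (?a + ?b) / (?a * ?b)"
      using pos by (simp add: divide_le_eq le_divide_eq mult.commute)
    also have "\<dots> = 1 / ?a + 1 / ?b"
      using pos by (simp add: field_simps)
    finally show ?thesis .
  qed
  finally have "graph_form G len w w \<le> 1 / ?a + 1 / ?b" .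
  moreover have "eigval_min G len 1 \<le> ereal (4 * graph_form G len w w)"
    using e by (intro eigval_min_le_graph_form[of "Inner e1 (?a / 2)" "Inner e2 (?b / 2)"])
      (auto simp: nodes_def w_def)
  ultimately show ?thesis
    by (elim order_trans) simp
qed

text \<open>Only the two halves of \<open>e\<close> carry energy, \<open>2 / len e\<close> each,
  whether or not \<open>e\<close> is a loop. The second point is the tail of \<open>e\<close>, where
  the tent is 0.\<close>

lemma eigval_min_le_edge:
  assumes e: "e \<in> arcs G"
  shows "eigval_min G len 1 \<le> ereal (4 * (4 / len e))"
proof -
  define w :: "('v, 'e) point \<Rightarrow> real" where "w x = of_bool (x = Inner e (len e / 2))" for x
  have "eigval_min G len 1 \<le> ereal (4 * graph_form G len w w)"
    using e tail_in_verts by (intro eigval_min_le_graph_form[of "Inner e (len e / 2)" "Vertex (tail G e)"])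
      (auto simp: nodes_def w_def)
  also have "graph_form G len w w = (\<Sum>e'\<in>arcs G. if e' = e then 4 / len e else 0)"
    unfolding graph_form_eq by (intro sum.cong) (auto simp: w_def)
  also have "\<dots> = 4 / len e"
    using e by simp
  finally show ?thesis .
qed

end

theorem proposition6p11:
  fixes G :: "('v, 'e) pre_digraph" and len :: "'e \<Rightarrow> real"
  assumes "metric_graph G len"
    and "essential G"
  shows "eigval_min G len 1 \<le> 4 * cheeger G len"
proof -
  interpret metric_graph G len by fact
  \<comment> \<open>Division by 4 turns the claim into a lower bound for
    \<open>cheeger G len\<close>, to be checked on each member of the three minima; an empty index
    set imposes no condition.\<close>
  define m where "m = eigval_min G len 1 / 4"
  have quarter: "m \<le> ereal c" if "eigval_min G len 1 \<le> ereal (4 * c)" for c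
    unfolding m_def using that by (subst ereal_divide_le_pos) auto
  have "m \<le> ereal (\<Sum>e\<in>edge_boundary G Y. 1 / len e)" if "Y \<in> {Y. Y \<noteq> {} \<and> Y \<subset> verts G}" for Y
    using that by (intro quarter eigval_min_le_edge_boundary) simp_all
  moreover have "m \<le> (case p of (e1, e2) \<Rightarrow> ereal (1 / len e1 + 1 / len e2))"
    if "p \<in> {(e1, e2). e1 \<in> arcs G \<and> e2 \<in> arcs G \<and> e1 \<noteq> e2}" for p
    using that quarter[OF eigval_min_le_two_edges] by (cases p) simp
  moreover have "m \<le> ereal (4 / len e)" if "e \<in> arcs G" for e
    using that by (intro quarter eigval_min_le_edge)
  ultimately have "m \<le> cheeger G len"
    unfolding cheeger_def by (intro min.boundedI INF_greatest)
  then show ?thesis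
    unfolding m_def by (subst (asm) ereal_divide_le_pos) auto
qed

end
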